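(* Let $\alpha^{+},\lambda^{+},\alpha^{-},\lambda^{-}\in(0,\infty)$, $\beta^{+},\beta^{-}\in[0,1)$, let $X\sim \mathrm{TSD}(\alpha^{+},\beta^{+},\lambda^{+};\alpha^{-},\beta^{-},\lambda^{-})$ with Lévy measure $\nu$, and let $r\ge 1$ be an integer. Then for every $h\in\mathcal{H}_{r}$, the function $f_{h}:\mathbb{R}\to\mathbb{R}$ defined by $$f_{h}(x):=-\int_{0}^{\infty}e^{-t}\int_{\mathbb{R}}h'(xe^{-t}+y)\,F_{X_{(t)}}(dy)\,dt$$ solves the Stein equation $$-xf_h(x)+\int_{\mathbb{R}}u f_h(x+u)\,\nu(du)=h(x)-\mathbb{E}h(X),\qquad x\in\mathbb{R}.$$
   Context: For $\alpha^{+},\lambda^{+},\alpha^{-},\lambda^{-}\in(0,\infty)$ and $\beta^{+},\beta^{-}\in[0,1)$, a random variable $X$ has the two-sided tempered stable distribution $\mathrm{TSD}(\alpha^{+},\beta^{+},\lambda^{+};\alpha^{-},\beta^{-},\lambda^{-})$ if its characteristic function is $\phi(z)=\exp\left(\int_{\mathbb{R}}(e^{izu}-1)\,\nu(du)\right)$, $z\in\mathbb{R}$, with Lévy measure $$\nu(du)=\left(\frac{\alpha^{+}}{u^{1+\beta^{+}}}e^{-\lambda^{+}u}\mathbf{1}_{(0,\infty)}(u)+\frac{\alpha^{-}}{|u|^{1+\beta^{-}}}e^{-\lambda^{-}|u|}\mathbf{1}_{(-\infty,0)}(u)\right)du.$$ For each $t\ge 0$, the function $\phi_t(z):=\phi(z)/\phi(e^{-t}z)$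 is a characteristic function (self-decomposability of $X$); $X_{(t)}$ denotes a random variable with characteristic function $\phi_t$ and $F_{X_{(t)}}$ its distribution. $\mathcal{H}_r$ is the set of $r$ times differentiable functions $h:\mathbb{R}\to\mathbb{R}$ with $\|h^{(k)}\|\le 1$ for $k=0,1,\ldots,r$, where $h^{(0)}=h$ and $\|f\|=\sup_{x\in\mathbb{R}}|f(x)|$. *)

theory Defs
  imports "HOL-Probability.Probability"
begin

definition tsd_levy_density ::
  "real \<Rightarrow> real \<Rightarrow> real \<Rightarrow> real \<Rightarrow> real \<Rightarrow> real \<Rightarrow> real \<Rightarrow> real" where
  "tsd_levy_density \<alpha>_p \<beta>_p lam_p \<alpha>_m \<beta>_m lam_m u =
     \<alpha>_p / u powr (1 + \<beta>_p) * exp (- lam_p * u) * indicator {0<..} u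
   + \<alpha>_m / \<bar>u\<bar> powr (1 + \<beta>_m) * exp (- lam_m * \<bar>u\<bar>) * indicator {..<0} u"

definition tsd_levy_measure ::
  "real \<Rightarrow> real \<Rightarrow> real \<Rightarrow> real \<Rightarrow> real \<Rightarrow> real \<Rightarrow> real measure" where
  "tsd_levy_measure \<alpha>_p \<beta>_p lam_p \<alpha>_m \<beta>_m lam_m =
     density lborel (\<lambda>u. ennreal (tsd_levy_density \<alpha>_p \<beta>_p lam_p \<alpha>_m \<beta>_m lam_m u))"

definition tsd_char ::
  "real \<Rightarrow> real \<Rightarrow> real \<Rightarrow> real \<Rightarrow> real \<Rightarrow> real \<Rightarrow> real \<Rightarrow> complex" where
  "tsd_char \<alpha>_p \<beta>_p lam_p \<alpha>_m \<beta>_m lam_m z =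
     exp (LINT u|tsd_levy_measure \<alpha>_p \<beta>_p lam_p \<alpha>_m \<beta>_m lam_m. iexp (z * u) - 1)"

definition has_TSD ::
  "'a measure \<Rightarrow> ('a \<Rightarrow> real) \<Rightarrow> real \<Rightarrow> real \<Rightarrow> real \<Rightarrow> real \<Rightarrow> real \<Rightarrow> real \<Rightarrow> bool" where
  "has_TSD M X \<alpha>_p \<beta>_p lam_p \<alpha>_m \<beta>_m lam_m \<longleftrightarrow>
     X \<in> borel_measurable M \<and>
     (\<forall>z. char (distr M borel X) z = tsd_char \<alpha>_p \<beta>_p lam_p \<alpha>_m \<beta>_m lam_m z)"

text \<open>The supremum is taken in the extended reals, so that the norm of an unbounded function
  is \<open>\<infinity>\<close> rather than an unspecified real number.\<close>

definition sup_norm :: "(real \<Rightarrow> real) \<Rightarrow> ereal" where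
  "sup_norm f = (SUP x. ereal \<bar>f x\<bar>)"

definition H_class :: "nat \<Rightarrow> (real \<Rightarrow> real) set" where
  "H_class r = {h. (\<forall>k<r. \<forall>x. ((deriv ^^ k) h) differentiable (at x)) \<and>
                   (\<forall>k\<le>r. sup_norm ((deriv ^^ k) h) \<le> 1)}"

text \<open>Here \<open>F t\<close> is the distribution of the random variable $X_{(t)}$.\<close>

definition stein_f :: "(real \<Rightarrow> real measure) \<Rightarrow> (real \<Rightarrow> real) \<Rightarrow> real \<Rightarrow> real" where
  "stein_f F h x =
     - (LINT t:{0..}|lborel. exp (- t) * (LINT y|F t. deriv h (x * exp (- t) + y)))"

text \<open>Bochner integrals of non-integrable functions are 0 by convention; this states that both
  integrals in \<open>stein_f F h x\<close> genuinely exist.\<close>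

definition stein_f_well_defined ::
  "(real \<Rightarrow> real measure) \<Rightarrow> (real \<Rightarrow> real) \<Rightarrow> real \<Rightarrow> bool" where
  "stein_f_well_defined F h x \<longleftrightarrow>
     (\<forall>t\<ge>0. integrable (F t) (\<lambda>y. deriv h (x * exp (- t) + y))) \<and>
     set_integrable lborel {0..}
       (\<lambda>t. exp (- t) * (LINT y|F t. deriv h (x * exp (- t) + y)))"

end

theory Submission imports Defs begin

text \<open>
  Let \<open>A x\<close> be the law with \<open>\<integral> g dA x = \<integral>\<^sub>0\<^sup>\<infinity> e\<^bsup>-t\<^esup> E g(x e\<^bsup>-t\<^esup> + X\<^bsub>(t)\<^esub>) dt\<close>, so that the Stein solution
  is \<open>f x = - \<integral> h' dA x\<close>. For \<open>h = exp(i z \<cdot>)\<close> the Stein equation is the fundamental theorem of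
  calculus for \<open>t \<mapsto> exp(i z x e\<^bsup>-t\<^esup>) \<phi>(z) / \<phi>(e\<^bsup>-t\<^esup> z)\<close> on \<open>[0, \<infinity>)\<close>. It therefore has the form
  \<open>\<Sum> a\<^sub>i N\<^sub>i(z) = i z \<Sum> b\<^sub>i N\<^sub>i(z)\<close> between characteristic functions of finitely many probability
  measures. Since \<open>h'\<close> need not be continuous, this is transferred to general \<open>h\<close> without
  approximation: dividing by \<open>1 - i z\<close> (convolving with the exponential law) gives an equality of
  finite signed measures by Levy's uniqueness theorem, and integrating \<open>h - h'\<close> against it gives
  the claim, because \<open>\<integral>\<^sub>0\<^sup>\<infinity> e\<^bsup>-s\<^esup> (h - h')(y + s) ds = h y\<close>.
\<close>

subsection \<open>Integrals over a half-line and over mixtures\<close>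

text \<open>Dominated convergence with majorant \<open>norm (g t)\<close> on the half-line: for each
  t the indicator of \<open>{0..real n}\<close> eventually agrees with that of
  \<open>{0..}\<close>.\<close>

lemma tendsto_integral_atLeast_nat:
  fixes g :: "real \<Rightarrow> 'a::{banach, second_countable_topology}"
  assumes g: "set_integrable lborel {0..} g"
  shows "(\<lambda>n. LINT t:{0..real n}|lborel. g t) \<longlonglongrightarrow> (LINT t:{0..}|lborel. g t)"
  unfolding set_lebesgue_integral_def
proof (rule integral_dominated_convergence)
  have "integrable lborel (\<lambda>t. indicator {0..} t *\<^sub>R g t)"
    using g by (simp add: set_integrable_def)
  then show "integrable lborel (\<lambda>t. norm (indicator {0..} t *\<^sub>R g t))" by (rule integrable_norm)
  show m: "(\<lambda>t. indicator {0..} t *\<^sub>R g t) \<in> borel_measurable lborel"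
    using g by (simp add: set_integrable_def)
  show "(\<lambda>t. indicator {0..real n} t *\<^sub>R g t) \<in> borel_measurable lborel" for n
  proof -
    \<comment> \<open>Only the product of \<open>g\<close> with the indicator of the half-line is
      known to be measurable, so the smaller indicator is multiplied onto that product.\<close>
    have "(\<lambda>t. indicator {0..real n} t *\<^sub>R (indicator {0..} t *\<^sub>R g t)) \<in> borel_measurable lborel"
      by (intro borel_measurable_scaleR[OF _ m]) auto
    moreover have "(\<lambda>t. indicator {0..real n} t *\<^sub>R (indicator {0..} t *\<^sub>R g t))
        = (\<lambda>t. indicator {0..real n} t *\<^sub>R g t)"
      by (auto simp: fun_eq_iff split: split_indicator)
    ultimately show ?thesis by simp
  qed
  show "AE t in lborel. (\<lambda>n. indicator {0..real n} t *\<^sub>R g t) \<longlonglongrightarrow> indicator {0..} t *\<^sub>R g t"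
  proof (intro AE_I2 tendsto_eventually)
    fix t :: real
    obtain N where "t \<le> real N" using real_arch_simple by blast
    then show "\<forall>\<^sub>F n in sequentially. indicator {0..real n} t *\<^sub>R g t = indicator {0..} t *\<^sub>R g t"
      by (intro eventually_sequentiallyI[of N]) (auto split: split_indicator)
  qed
qed (auto split: split_indicator)

text \<open>The gauge-integral fundamental theorem on each \<open>{0..real n}\<close> asks for a
  derivative but not for its continuity; absolute integrability turns the result into a Lebesgue
  integral, and n tends to infinity.\<close>

lemma integral_FTC_atLeast_tendsto:
  fixes G :: "real \<Rightarrow> 'a::euclidean_space"
  assumes g: "set_integrable lborel {0..} g"
    and G: "\<And>t. 0 \<le> t \<Longrightarrow> (G has_vector_derivative g t) (at t within {0..})"
    and L: "(G \<longlongrightarrow> L) at_top"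
  shows "(LINT t:{0..}|lborel. g t) = L - G 0"
proof (rule LIMSEQ_unique[OF tendsto_integral_atLeast_nat[OF g]])
  have "(LINT t:{0..real n}|lborel. g t) = G n - G 0" for n
  proof -
    have "(g has_integral (G n - G 0)) {0..real n}"
      by (rule fundamental_theorem_of_calculus)
         (auto intro!: has_vector_derivative_within_subset[OF G])
    moreover have "set_integrable lborel {0..real n} g"
      by (rule set_integrable_subset[OF g]) auto
    ultimately show ?thesis
      by (simp add: set_borel_integral_eq_integral integral_unique)
  qed
  moreover have "(\<lambda>n. G (real n) - G 0) \<longlonglongrightarrow> L - G 0"
    by (intro tendsto_intros filterlim_compose[OF L] filterlim_real_sequentially)
  ultimately show "(\<lambda>n. LINT t:{0..real n}|lborel. g t) \<longlonglongrightarrow> L - G 0"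
    by simp
qed

section \<open>Measurability of differentiable functions and their derivatives\<close>

lemma borel_measurable_differentiable_real:
  fixes h :: "real \<Rightarrow> real"
  assumes h: "\<And>x. h differentiable (at x)"
  shows "h \<in> borel_measurable borel"
  using h by (intro borel_measurable_continuous_onI continuous_at_imp_continuous_on)
    (auto intro: differentiable_imp_continuous_within)

text \<open>The derivative is the pointwise limit of the difference quotients with step
  \<open>1 / real (Suc n)\<close>, which are Borel because \<open>h\<close> is continuous.\<close>

lemma borel_measurable_deriv_real:
  fixes h :: "real \<Rightarrow> real"
  assumes h: "\<And>x. h differentiable (at x)"
  shows "deriv h \<in> borel_measurable borel"
proof (rule borel_measurable_LIMSEQ_metric)
  have c: "h \<in> borel_measurable borel"
    by (rule borel_measurable_differentiable_real[OF h])
  show "(\<lambda>x. (h (x + 1 / real (Suc n)) - h x) / (1 / real (Suc n))) \<in> borel_measurable borel" for n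
    using c by measurable
  fix x :: real
  have "(h has_real_derivative deriv h x) (at x)"
    using h[of x] by (simp add: DERIV_deriv_iff_real_differentiable)
  then have "((\<lambda>y. (h (x + y) - h x) / y) \<longlongrightarrow> deriv h x) (at 0)"
    by (simp add: DERIV_def)
  moreover have "filterlim (\<lambda>n. 1 / real (Suc n)) (at 0) sequentially"
    using LIMSEQ_inverse_real_of_nat unfolding filterlim_at inverse_eq_divide by auto
  ultimately show "(\<lambda>n. (h (x + 1 / real (Suc n)) - h x) / (1 / real (Suc n))) \<longlonglongrightarrow> deriv h x"
    by (rule filterlim_compose)
qed

section \<open>Bounded integrands and mixtures of probability measures\<close>

lemma (in prob_space) norm_expectation_le:
  fixes g :: "'a \<Rightarrow> 'b::{banach, second_countable_topology}"
  assumes "g \<in> borel_measurable M" and B: "\<And>x. x \<in> space M \<Longrightarrow> norm (g x) \<le> B"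
  shows "norm (expectation g) \<le> B"
proof -
  have i: "integrable M g"
    using assms by (intro integrable_const_bound[of _ B]) auto
  have "norm (expectation g) \<le> expectation (\<lambda>x. norm (g x))" by (rule integral_norm_bound)
  also have "\<dots> \<le> expectation (\<lambda>x. B)"
    using B by (intro integral_mono integrable_norm i) auto
  finally show ?thesis by (simp add: prob_space)
qed

text \<open>The real mixture formula is applied to real and imaginary parts. The bound
  \<open>B\<close> makes \<open>f\<close> integrable under the mixture and under every component, so
  the two parts can be reassembled.\<close>

lemma integral_bind_complex:
  fixes f :: "'b \<Rightarrow> complex"
  assumes f[measurable]: "f \<in> borel_measurable K"
    and B: "\<And>x. x \<in> space K \<Longrightarrow> cmod (f x) \<le> B"
    and N: "N \<in> M \<rightarrow>\<^sub>M prob_algebra K" and M: "prob_space M"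
  shows "integral\<^sup>L (M \<bind> N) f = (LINT x|M. integral\<^sup>L (N x) f)"
proof -
  interpret prob_space M by fact
  note N'[measurable] = measurable_prob_algebraD[OF N]
  have spN: "N x \<in> space (prob_algebra K)" if "x \<in> space M" for x
    using measurable_space[OF N that] .
  have b: "AE x in M. emeasure (N x) (space (N x)) \<le> ennreal 1"
    using spN by (intro AE_I2) (auto simp: space_prob_algebra prob_space.emeasure_space_1)
  have R: "\<bar>Re (f x)\<bar> \<le> B" "\<bar>Im (f x)\<bar> \<le> B" if "x \<in> space K" for x
    using B[OF that] abs_Re_le_cmod[of "f x"] abs_Im_le_cmod[of "f x"] by linarith+
  have int_R: "integrable (M \<bind> N) (\<lambda>x. Re (f x))" "integrable (M \<bind> N) (\<lambda>x. Im (f x))"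
    using R by (auto intro!: integrable_bind[OF _ _ N' finite_measure_axioms b])
  have "integrable (M \<bind> N) (\<lambda>x. Re (f x) + \<i> * Im (f x))"
    using int_R by (intro Bochner_Integration.integrable_add integrable_mult_right integrable_of_real)
  then have int_f: "integrable (M \<bind> N) f"
    by (simp only: complex_eq[symmetric])
  have int_N: "integrable (N x) f" if "x \<in> space M" for x
  proof -
    interpret N: prob_space "N x" using spN[OF that] by (simp add: space_prob_algebra)
    have s: "sets (N x) = sets K" using spN[OF that] by (simp add: space_prob_algebra)
    show ?thesis using B s
      by (intro N.integrable_const_bound[of _ B])
         (auto simp: sets_eq_imp_space_eq[OF s] cong: measurable_cong_sets)
  qed
  have "integrable M (\<lambda>x. integral\<^sup>L (N x) f)"
  proof (rule integrable_const_bound[of _ B])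
    show "(\<lambda>x. integral\<^sup>L (N x) f) \<in> borel_measurable M" by measurable
    show "AE x in M. cmod (integral\<^sup>L (N x) f) \<le> B"
    proof (rule AE_I2)
      fix x assume x: "x \<in> space M"
      interpret N: prob_space "N x" using spN[OF x] by (simp add: space_prob_algebra)
      have s: "sets (N x) = sets K" using spN[OF x] by (simp add: space_prob_algebra)
      show "cmod (integral\<^sup>L (N x) f) \<le> B"
        using B s by (intro N.norm_expectation_le)
          (auto simp: sets_eq_imp_space_eq[OF s] cong: measurable_cong_sets)
    qed
  qed
  then have "(LINT x|M. (LINT y|N x. Re (f y))) = Re (LINT x|M. integral\<^sup>L (N x) f)"
    "(LINT x|M. (LINT y|N x. Im (f y))) = Im (LINT x|M. integral\<^sup>L (N x) f)"
    by (simp_all add: integral_Re integral_Im int_N cong: Bochner_Integration.integral_cong)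
  moreover have "(LINT x|(M \<bind> N). Re (f x)) = (LINT x|M. (LINT y|N x. Re (f y)))"
    "(LINT x|(M \<bind> N). Im (f x)) = (LINT x|M. (LINT y|N x. Im (f y)))"
    using R by (auto intro!: integral_bind[OF _ _ N' finite_measure_axioms b])
  ultimately show ?thesis using int_f by (simp add: complex_eq_iff integral_Re integral_Im)
qed

lemma integral_bind_prob:
  fixes f :: "'b \<Rightarrow> real"
  assumes f[measurable]: "f \<in> borel_measurable K"
    and B: "\<And>x. x \<in> space K \<Longrightarrow> \<bar>f x\<bar> \<le> B"
    and N: "N \<in> M \<rightarrow>\<^sub>M prob_algebra K" and M: "prob_space M"
  shows "integral\<^sup>L (M \<bind> N) f = (LINT x|M. integral\<^sup>L (N x) f)"
proof (rule integral_bind[OF f B measurable_prob_algebraD[OF N]])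
  show "AE x in M. emeasure (N x) (space (N x)) \<le> ennreal 1"
    using measurable_space[OF N]
    by (intro AE_I2) (auto simp: space_prob_algebra prob_space.emeasure_space_1)
qed (use M in \<open>auto simp: prob_space_def\<close>)

lemma real_distribution_iff_prob_algebra:
  "real_distribution N \<longleftrightarrow> N \<in> space (prob_algebra borel)"
  by (auto simp: real_distribution_def real_distribution_axioms_def space_prob_algebra)

text \<open>The weights form a probability mass function on \<open>I\<close>; drawing i from it and
  then a point from \<open>N i\<close> gives \<open>P\<close>.\<close>

lemma real_distribution_mixture:
  fixes N :: "'i \<Rightarrow> real measure"
  assumes I: "finite I" and N: "\<And>i. i \<in> I \<Longrightarrow> real_distribution (N i)"
    and c: "\<And>i. i \<in> I \<Longrightarrow> 0 \<le> c i" "(\<Sum>i\<in>I. c i) = (1::real)"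
  obtains P where "real_distribution P"
    "\<And>z. char P z = (\<Sum>i\<in>I. c i * char (N i) z)"
    "\<And>(g::real \<Rightarrow> real) B. g \<in> borel_measurable borel \<Longrightarrow> (\<And>x. \<bar>g x\<bar> \<le> B) \<Longrightarrow>
       integral\<^sup>L P g = (\<Sum>i\<in>I. c i * integral\<^sup>L (N i) g)"
proof -
  \<comment> \<open>The kernel must be a probability measure at every index of the type, so outside
    \<open>I\<close> the weight is 0 and the law is a point mass.\<close>
  define d where "d i = (if i \<in> I then c i else 0)" for i
  define p where "p = embed_pmf d"
  define N' where "N' i = (if i \<in> I then N i else return borel 0)" for i
  have d0: "\<And>i. 0 \<le> d i" using c by (simp add: d_def)
  have "(\<integral>\<^sup>+i. ennreal (d i) \<partial>count_space UNIV) = (\<Sum>i\<in>I. ennreal (d i))"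
    using I by (intro nn_integral_count_space'[OF I]) (auto simp: d_def)
  also have "\<dots> = 1"
    using c d0 by (subst sum_ennreal) (auto simp: d_def)
  finally have p: "pmf p i = d i" for i
    using d0 unfolding p_def by (intro pmf_embed_pmf) auto
  have supp: "set_pmf p \<subseteq> I" using p by (auto simp: set_pmf_eq d_def split: if_splits)
  have N': "N' \<in> measure_pmf p \<rightarrow>\<^sub>M prob_algebra borel"
    using N by (auto simp: N'_def real_distribution_iff_prob_algebra[symmetric] real_distribution_def
      real_distribution_axioms_def prob_space_return)
  define P where "P = measure_pmf p \<bind> N'"
  have P: "real_distribution P"
    unfolding real_distribution_iff_prob_algebra P_def
    using N' prob_space_bind'[of "measure_pmf p" "count_space UNIV" N' borel]
      sets_bind'[of "measure_pmf p" "count_space UNIV" N' borel]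
    by (auto simp: space_prob_algebra measure_pmf.prob_space_axioms)
  show thesis
  proof (rule that[OF P])
    fix z
    have "char P z = (LINT i|p. char (N' i) z)"
      unfolding char_def P_def
      by (rule integral_bind_complex[OF _ _ N', where B=1]) (auto simp: measure_pmf.prob_space_axioms)
    also have "\<dots> = (\<Sum>i\<in>I. d i *\<^sub>R char (N' i) z)"
      using supp by (subst integral_measure_pmf[OF I]) (auto simp: p)
    also have "\<dots> = (\<Sum>i\<in>I. c i * char (N i) z)"
      by (intro sum.cong) (auto simp: d_def N'_def scaleR_conv_of_real)
    finally show "char P z = (\<Sum>i\<in>I. c i * char (N i) z)" .
  next
    fix g :: "real \<Rightarrow> real" and B
    assume g: "g \<in> borel_measurable borel" "\<And>x. \<bar>g x\<bar> \<le> B"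
    have "integral\<^sup>L P g = (LINT i|p. integral\<^sup>L (N' i) g)"
      unfolding P_def using g
      by (intro integral_bind_prob[OF _ _ N', where B=B]) (auto simp: measure_pmf.prob_space_axioms)
    also have "\<dots> = (\<Sum>i\<in>I. d i *\<^sub>R integral\<^sup>L (N' i) g)"
      using supp by (subst integral_measure_pmf[OF I]) (auto simp: p)
    also have "\<dots> = (\<Sum>i\<in>I. c i * integral\<^sup>L (N i) g)"
      by (intro sum.cong) (auto simp: d_def N'_def)
    finally show "integral\<^sup>L P g = (\<Sum>i\<in>I. c i * integral\<^sup>L (N i) g)" .
  qed
qed

subsection \<open>Identities between characteristic functions\<close>

text \<open>The positive and the negative part of the signed combination have the same total mass
  \<open>S\<close>. Normalised by \<open>S\<close>, they are probability measures with equal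
  characteristic functions, hence equal by Levy's uniqueness theorem.\<close>

lemma signed_char_uniqueness:
  fixes N :: "'i \<Rightarrow> real measure" and c :: "'i \<Rightarrow> real" and g :: "real \<Rightarrow> real"
  assumes I: "finite I" and N: "\<And>i. i \<in> I \<Longrightarrow> real_distribution (N i)"
    and ch: "\<And>z. (\<Sum>i\<in>I. c i * char (N i) z) = 0"
    and g: "g \<in> borel_measurable borel" "\<And>x. \<bar>g x\<bar> \<le> B"
  shows "(\<Sum>i\<in>I. c i * integral\<^sup>L (N i) g) = 0"
proof -
  define S where "S = (\<Sum>i\<in>I. max 0 (c i))"
  \<comment> \<open>At 0 every characteristic function equals 1, so the hypothesis forces the
    coefficients to sum to zero.\<close>
  have "complex_of_real (\<Sum>i\<in>I. c i) = (\<Sum>i\<in>I. c i * char (N i) 0)"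
    using N by (auto simp: real_distribution.char_zero)
  then have "(\<Sum>i\<in>I. c i) = 0" using ch[of 0] of_real_eq_0_iff by metis
  moreover have "(\<Sum>i\<in>I. c i) = (\<Sum>i\<in>I. max 0 (c i)) - (\<Sum>i\<in>I. max 0 (- c i))"
    unfolding sum_subtractf[symmetric] by (intro sum.cong) auto
  ultimately have S': "S = (\<Sum>i\<in>I. max 0 (- c i))" by (simp add: S_def)
  show ?thesis
  \<comment> \<open>Normalisation requires \<open>S > 0\<close>; for \<open>S = 0\<close> both parts
    vanish termwise, hence so does every coefficient.\<close>
  proof (cases "S = 0")
    case True
    have "max 0 (c i) = 0" "max 0 (- c i) = 0" if "i \<in> I" for i
      using True that S' I by (auto simp: S_def sum_nonneg_eq_0_iff)
    then have "c i = 0" if "i \<in> I" for i using that by (smt (verit))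
    then show ?thesis by simp
  next
    case False
    have S0: "S > 0" using False by (simp add: S_def order_less_le sum_nonneg)
    obtain P where P: "real_distribution P"
      "\<And>z. char P z = (\<Sum>i\<in>I. (max 0 (c i) / S) * char (N i) z)"
      "\<And>(g::real \<Rightarrow> real) B. g \<in> borel_measurable borel \<Longrightarrow> (\<And>x. \<bar>g x\<bar> \<le> B) \<Longrightarrow>
         integral\<^sup>L P g = (\<Sum>i\<in>I. (max 0 (c i) / S) * integral\<^sup>L (N i) g)"
      by (rule real_distribution_mixture[OF I N, where c="\<lambda>i. max 0 (c i) / S"])
        (use S0 in \<open>auto simp: sum_divide_distrib[symmetric] S_def[symmetric]\<close>)
    obtain Q where Q: "real_distribution Q"
      "\<And>z. char Q z = (\<Sum>i\<in>I. (max 0 (- c i) / S) * char (N i) z)"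
      "\<And>(g::real \<Rightarrow> real) B. g \<in> borel_measurable borel \<Longrightarrow> (\<And>x. \<bar>g x\<bar> \<le> B) \<Longrightarrow>
         integral\<^sup>L Q g = (\<Sum>i\<in>I. (max 0 (- c i) / S) * integral\<^sup>L (N i) g)"
      by (rule real_distribution_mixture[OF I N, where c="\<lambda>i. max 0 (- c i) / S"])
        (use S0 in \<open>auto simp: sum_divide_distrib[symmetric] S'[symmetric]\<close>)
    have d: "max 0 (c i) / S - max 0 (- c i) / S = c i / S" for i
      by (simp add: diff_divide_distrib[symmetric]) (simp add: max_def)
    have "char P z - char Q z = 0" for z
    proof -
      have "char P z - char Q z = (\<Sum>i\<in>I. complex_of_real (c i / S) * char (N i) z)"
        unfolding P(2) Q(2) sum_subtractf[symmetric] left_diff_distrib[symmetric]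
          of_real_diff[symmetric] d ..
      also have "\<dots> = (\<Sum>i\<in>I. c i * char (N i) z) / S"
        by (simp add: sum_divide_distrib)
      finally show ?thesis using ch by simp
    qed
    then have "P = Q"
      by (intro Levy_uniqueness P Q) (auto simp: fun_eq_iff)
    then have "0 = integral\<^sup>L P g - integral\<^sup>L Q g" by simp
    also have "\<dots> = (\<Sum>i\<in>I. (c i / S) * integral\<^sup>L (N i) g)"
      unfolding P(3)[OF g] Q(3)[OF g] sum_subtractf[symmetric] left_diff_distrib[symmetric] d ..
    also have "\<dots> = (\<Sum>i\<in>I. c i * integral\<^sup>L (N i) g) / S"
      by (simp add: sum_divide_distrib)
    finally show ?thesis using S0 by simp
  qed
qed

section \<open>The standard exponential law and convolution with it\<close>

definition exp_law :: "real measure" where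
  "exp_law = density lborel (exponential_density 1)"

lemma real_distribution_exp_law: "real_distribution exp_law"
  unfolding exp_law_def real_distribution_def real_distribution_axioms_def
  using prob_space_exponential_density[of 1] by simp

lemma integral_exp_law:
  fixes f :: "real \<Rightarrow> 'a::{banach, second_countable_topology}"
  assumes f: "f \<in> borel_measurable borel"
  shows "integral\<^sup>L exp_law f = (LINT t:{0..}|lborel. exp (- t) *\<^sub>R f t)"
proof -
  have "integral\<^sup>L exp_law f = (LINT t|lborel. exponential_density 1 t *\<^sub>R f t)"
    unfolding exp_law_def using f
    by (intro integral_density) (auto simp: exponential_density_nonneg)
  also have "\<dots> = (LINT t:{0..}|lborel. exp (- t) *\<^sub>R f t)"
    unfolding set_lebesgue_integral_def
    by (intro Bochner_Integration.integral_cong) (auto simp: exponential_density_def)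
  finally show ?thesis .
qed

lemma set_integrable_exp_bounded:
  fixes f :: "real \<Rightarrow> 'a::{banach, second_countable_topology}"
  assumes f: "f \<in> borel_measurable borel" and B: "\<And>t. 0 \<le> t \<Longrightarrow> norm (f t) \<le> B"
  shows "set_integrable lborel {0..} (\<lambda>t. exp (- t) *\<^sub>R f t)"
proof -
  interpret E: real_distribution exp_law by (rule real_distribution_exp_law)
  \<comment> \<open>The bound on \<open>f\<close> is assumed for nonnegative t only, which is almost
    everywhere under this law.\<close>
  have "AE t in exp_law. 0 \<le> t"
    unfolding exp_law_def
    by (subst AE_density) (auto simp: exponential_density_def ennreal_zero_less_one intro!: AE_I2)
  then have "AE t in exp_law. norm (f t) \<le> B" using B by auto
  then have "integrable exp_law f"
    using f by (intro E.integrable_const_bound[of _ B]) auto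
  then have "integrable lborel (\<lambda>t. exponential_density 1 t *\<^sub>R f t)"
    unfolding exp_law_def using f
    by (subst (asm) integrable_density) (auto simp: exponential_density_nonneg)
  then show ?thesis
    unfolding set_integrable_def
    by (rule Bochner_Integration.integrable_cong[THEN iffD1, rotated 2])
       (auto simp: exponential_density_def)
qed

text \<open>With \<open>w = 1 - \<i> * z\<close>, nonzero because its real part is 1, the function
  \<open>- exp (- t * w) / w\<close> is an antiderivative of the integrand and has norm
  \<open>exp (- t) / cmod w\<close>, which tends to 0.\<close>

lemma char_exp_law: "char exp_law z = 1 / (1 - \<i> * z)"
proof -
  let ?w = "1 - \<i> * complex_of_real z"
  have w: "?w \<noteq> 0" by (auto simp: complex_eq_iff)
  have "char exp_law z = (LINT t:{0..}|lborel. exp (- t) *\<^sub>R iexp (z * t))"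
    unfolding char_def by (rule integral_exp_law) auto
  also have "\<dots> = 0 - - exp (- of_real 0 * ?w) / ?w"
  proof (rule integral_FTC_atLeast_tendsto)
    show "set_integrable lborel {0..} (\<lambda>t. exp (- t) *\<^sub>R iexp (z * t))"
      by (rule set_integrable_exp_bounded[where B=1]) auto
    have e: "exp (- t) *\<^sub>R iexp (z * t) = exp (- of_real t * ?w)" for t
      by (simp add: scaleR_conv_of_real exp_of_real[symmetric] exp_add[symmetric] algebra_simps)
    show "((\<lambda>t. - exp (- of_real t * ?w) / ?w) has_vector_derivative exp (- t) *\<^sub>R iexp (z * t))
        (at t within {0..})" for t :: real
      unfolding e using w
      by (auto intro!: derivative_eq_intros has_vector_derivative_real_field simp: divide_simps) (simp add: algebra_simps)
    have l: "((\<lambda>t::real. exp (- t) / cmod ?w) \<longlongrightarrow> 0 / cmod ?w) at_top"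
      by (intro tendsto_divide tendsto_const filterlim_compose[OF exp_at_bot]
          filterlim_uminus_at_bot_at_top) (use w in auto)
    show "((\<lambda>t::real. - exp (- of_real t * ?w) / ?w) \<longlongrightarrow> 0) at_top"
      by (rule Lim_null_comparison[OF _ l[unfolded div_0]])
         (auto simp: norm_divide)
  qed
  finally show ?thesis by simp
qed

text \<open>\<open>P\<close> is the law of Y + S with Y of law \<open>N\<close> and S an independent
  exponential variable. Building it as a mixture over y of shifted exponential laws gives the
  iterated integral directly.\<close>

lemma real_distribution_add_exp_law:
  assumes N: "real_distribution N"
  obtains P where "real_distribution P" "\<And>z. char P z = char N z / (1 - \<i> * z)"
    "\<And>(g::real \<Rightarrow> real) B. g \<in> borel_measurable borel \<Longrightarrow> (\<And>x. \<bar>g x\<bar> \<le> B) \<Longrightarrow>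
       integral\<^sup>L P g = (LINT y|N. (LINT s:{0..}|lborel. exp (- s) * g (y + s)))"
proof -
  interpret N: real_distribution N by fact
  interpret E: real_distribution exp_law by (rule real_distribution_exp_law)
  let ?K = "\<lambda>y. distr exp_law borel (\<lambda>s. y + s)"
  have E: "exp_law \<in> space (prob_algebra borel)"
    using real_distribution_exp_law by (simp add: real_distribution_iff_prob_algebra)
  have "?K \<in> borel \<rightarrow>\<^sub>M prob_algebra borel"
    by (rule measurable_distr_prob_space2[where M=borel, OF measurable_const[OF E]]) measurable
  then have K: "?K \<in> N \<rightarrow>\<^sub>M prob_algebra borel"
    by (simp cong: measurable_cong_sets)
  have P: "real_distribution (N \<bind> ?K)"
    unfolding real_distribution_iff_prob_algebra
    using N K prob_space_bind'[of N N ?K borel] sets_bind'[of N N ?K borel]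
    by (auto simp: space_prob_algebra N.prob_space_axioms)
  show thesis
  proof (rule that[OF P])
    fix z
    have "char (N \<bind> ?K) z = (LINT y|N. char (?K y) z)"
      unfolding char_def
      by (rule integral_bind_complex[OF _ _ K, where B=1]) (auto simp: N.prob_space_axioms)
    also have "\<dots> = (LINT y|N. iexp (z * y) * char exp_law z)"
    proof (rule Bochner_Integration.integral_cong[OF refl])
      fix y
      have "char (?K y) z = (LINT s|exp_law. iexp (z * (y + s)))"
        unfolding char_def by (subst integral_distr) auto
      also have "\<dots> = (LINT s|exp_law. iexp (z * y) * iexp (z * s))"
        by (simp add: exp_add[symmetric] algebra_simps)
      finally show "char (?K y) z = iexp (z * y) * char exp_law z"
        by (simp add: char_def)
    qed
    finally show "char (N \<bind> ?K) z = char N z / (1 - \<i> * z)"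
      unfolding char_exp_law char_def[of N] by simp
  next
    fix g :: "real \<Rightarrow> real" and B
    assume g[measurable]: "g \<in> borel_measurable borel" and B: "\<And>x. \<bar>g x\<bar> \<le> B"
    have "integral\<^sup>L (N \<bind> ?K) g = (LINT y|N. integral\<^sup>L (?K y) g)"
      using B by (intro integral_bind_prob[OF g _ K, where B=B]) (auto simp: N.prob_space_axioms)
    also have "\<dots> = (LINT y|N. (LINT s:{0..}|lborel. exp (- s) * g (y + s)))"
      by (intro Bochner_Integration.integral_cong refl)
         (simp add: integral_distr integral_exp_law)
    finally show "integral\<^sup>L (N \<bind> ?K) g = \<dots>" .
  qed
qed

text \<open>The function \<open>- exp (- s) * h (y + s)\<close> is an antiderivative of the
  integrand and vanishes at infinity because \<open>h\<close> is bounded. In operator terms, the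
  exponential average inverts 1 - D, where D is differentiation.\<close>

lemma exp_law_resolvent:
  fixes h :: "real \<Rightarrow> real"
  assumes h: "\<And>x. h differentiable (at x)" and B: "\<And>x. \<bar>h x\<bar> \<le> B" "\<And>x. \<bar>deriv h x\<bar> \<le> B'"
  shows "(LINT s:{0..}|lborel. exp (- s) * (h (y + s) - deriv h (y + s))) = h y"
proof -
  note [measurable] = borel_measurable_deriv_real[OF h]
  have [measurable]: "h \<in> borel_measurable borel"
    by (rule borel_measurable_differentiable_real[OF h])
  have "(LINT s:{0..}|lborel. exp (- s) * (h (y + s) - deriv h (y + s))) = 0 - - exp (- 0) * h (y + 0)"
  proof (rule integral_FTC_atLeast_tendsto)
    show "set_integrable lborel {0..} (\<lambda>s. exp (- s) * (h (y + s) - deriv h (y + s)))"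
      unfolding real_scaleR_def[symmetric]
    proof (rule set_integrable_exp_bounded)
      show "norm (h (y + s) - deriv h (y + s)) \<le> B + B'" for s
        using B(1)[of "y + s"] B(2)[of "y + s"] by auto
    qed measurable
    fix s :: real
    have "(h has_real_derivative deriv h (y + s)) (at (y + s))"
      using h by (simp add: DERIV_deriv_iff_real_differentiable)
    then have "((\<lambda>s. h (y + s)) has_real_derivative deriv h (y + s)) (at s)"
      by (simp add: DERIV_shift add.commute)
    then have "((\<lambda>s. - exp (- s) * h (y + s)) has_real_derivative
        exp (- s) * (h (y + s) - deriv h (y + s))) (at s)"
      by (auto intro!: derivative_eq_intros simp: algebra_simps)
    then show "((\<lambda>s. - exp (- s) * h (y + s)) has_vector_derivative
        exp (- s) * (h (y + s) - deriv h (y + s))) (at s within {0..})"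
      by (simp add: has_real_derivative_iff_has_vector_derivative has_vector_derivative_at_within)
  next
    have l: "((\<lambda>s::real. exp (- s) * B) \<longlongrightarrow> 0 * B) at_top"
      by (intro tendsto_mult tendsto_const filterlim_compose[OF exp_at_bot]
          filterlim_uminus_at_bot_at_top)
    show "((\<lambda>s::real. - exp (- s) * h (y + s)) \<longlongrightarrow> 0) at_top"
      by (rule Lim_null_comparison[OF _ l[unfolded mult_zero_left]])
         (auto simp: abs_mult intro!: mult_left_mono B always_eventually)
  qed
  then show ?thesis by simp
qed

text \<open>Multiplying the hypothesis by \<open>1 / (1 - i z)\<close>, the characteristic function of the exponential
  law, turns \<open>i z\<close> into the bounded symbol \<open>1 / (1 - i z) - 1\<close>.\<close>

lemma char_derivative_identity:
  fixes N :: "'i \<Rightarrow> real measure" and a b :: "'i \<Rightarrow> real" and h :: "real \<Rightarrow> real"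
  assumes I: "finite I" and N: "\<And>i. i \<in> I \<Longrightarrow> real_distribution (N i)"
    and ch: "\<And>z. (\<Sum>i\<in>I. a i * char (N i) z) = \<i> * z * (\<Sum>i\<in>I. b i * char (N i) z)"
    and h: "\<And>x. h differentiable (at x)" and B: "\<And>x. \<bar>h x\<bar> \<le> B" "\<And>x. \<bar>deriv h x\<bar> \<le> B'"
  shows "(\<Sum>i\<in>I. a i * integral\<^sup>L (N i) h) = (\<Sum>i\<in>I. b i * integral\<^sup>L (N i) (deriv h))"
proof -
  have hm[measurable]: "h \<in> borel_measurable borel"
    by (rule borel_measurable_differentiable_real[OF h])
  note dm[measurable] = borel_measurable_deriv_real[OF h]
  \<comment> \<open>Against a law smoothed by the exponential this test function integrates to the
    integral of \<open>h\<close>; against the original law it leaves the difference of the integrals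
    of \<open>h\<close> and \<open>deriv h\<close>.\<close>
  define g where "g x = h x - deriv h x" for x
  have g: "g \<in> borel_measurable borel" unfolding g_def by measurable
  have gB: "\<bar>g x\<bar> \<le> B + B'" for x
    unfolding g_def using B(1)[of x] B(2)[of x] by linarith
  have "\<exists>P. real_distribution P \<and> (\<forall>z. char P z = char (N i) z / (1 - \<i> * z)) \<and>
     integral\<^sup>L P g = integral\<^sup>L (N i) h" if i: "i \<in> I" for i
  proof -
    obtain P where P: "real_distribution P" "\<And>z. char P z = char (N i) z / (1 - \<i> * z)"
      "\<And>(g::real \<Rightarrow> real) B. g \<in> borel_measurable borel \<Longrightarrow> (\<And>x. \<bar>g x\<bar> \<le> B) \<Longrightarrow>
         integral\<^sup>L P g = (LINT y|N i. (LINT s:{0..}|lborel. exp (- s) * g (y + s)))"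
      using real_distribution_add_exp_law[OF N[OF i]] by blast
    have "integral\<^sup>L P g = (LINT y|N i. (LINT s:{0..}|lborel. exp (- s) * g (y + s)))"
      by (rule P(3)[OF g gB])
    also have "\<dots> = integral\<^sup>L (N i) h"
      unfolding g_def exp_law_resolvent[OF h B] ..
    finally show ?thesis using P by blast
  qed
  then obtain P where P: "\<And>i. i \<in> I \<Longrightarrow> real_distribution (P i)"
    "\<And>i z. i \<in> I \<Longrightarrow> char (P i) z = char (N i) z / (1 - \<i> * z)"
    "\<And>i. i \<in> I \<Longrightarrow> integral\<^sup>L (P i) g = integral\<^sup>L (N i) h"
    by metis
  \<comment> \<open>The Boolean marks smoothed (\<open>True\<close>) and original
    (\<open>False\<close>) laws. As
    \<open>\<i> * z / (1 - \<i> * z) = 1 / (1 - \<i> * z) - 1\<close>, dividing the hypothesis puts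
    weight \<open>a i - b i\<close> on \<open>P i\<close> and \<open>b i\<close> on
    \<open>N i\<close>.\<close>
  define Q where "Q j = (if snd j then P (fst j) else N (fst j))" for j :: "'i \<times> bool"
  define c where "c j = (if snd j then a (fst j) - b (fst j) else b (fst j))" for j :: "'i \<times> bool"
  have split: "(\<Sum>j\<in>I \<times> UNIV. f j) = (\<Sum>i\<in>I. f (i, True)) + (\<Sum>i\<in>I. f (i, False))"
    for f :: "'i \<times> bool \<Rightarrow> 'c::comm_monoid_add"
  proof -
    have "(\<Sum>j\<in>I \<times> UNIV. f j) = (\<Sum>i\<in>I. \<Sum>t\<in>UNIV. f (i, t))"
      by (simp add: sum.cartesian_product)
    then show ?thesis by (simp add: UNIV_bool sum.distrib add.commute)
  qed
  have "(\<Sum>j\<in>I \<times> UNIV. c j * integral\<^sup>L (Q j) g) = 0"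
  proof (rule signed_char_uniqueness[OF _ _ _ g gB])
    fix z :: real
    let ?w = "1 - \<i> * complex_of_real z"
    have w: "?w \<noteq> 0" by (auto simp: complex_eq_iff)
    have "(\<Sum>j\<in>I \<times> UNIV. c j * char (Q j) z)
       = (\<Sum>i\<in>I. (a i - b i) * (char (N i) z / ?w)) + (\<Sum>i\<in>I. b i * char (N i) z)"
      by (subst split) (auto simp: c_def Q_def P)
    also have "\<dots> = ((\<Sum>i\<in>I. a i * char (N i) z) - (\<Sum>i\<in>I. b i * char (N i) z)) / ?w
        + (\<Sum>i\<in>I. b i * char (N i) z)"
      by (simp add: sum_subtractf[symmetric] sum_divide_distrib left_diff_distrib)
    also have "\<dots> = 0"
    proof -
      have "\<i> * z * S - S = - (?w * S)" for S by (simp add: algebra_simps)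
      then show ?thesis unfolding ch using w by simp
    qed
    finally show "(\<Sum>j\<in>I \<times> UNIV. c j * char (Q j) z) = 0" .
  qed (use I N P in \<open>auto simp: Q_def\<close>)
  then have "(\<Sum>i\<in>I. (a i - b i) * integral\<^sup>L (N i) h) + (\<Sum>i\<in>I. b i * integral\<^sup>L (N i) g) = 0"
    by (subst (asm) split) (simp add: c_def Q_def P)
  \<comment> \<open>After this substitution the terms \<open>b i\<close> times the integral of
    \<open>h\<close> cancel.\<close>
  moreover have "integral\<^sup>L (N i) g = integral\<^sup>L (N i) h - integral\<^sup>L (N i) (deriv h)" if "i \<in> I" for i
  proof -
    interpret real_distribution "N i" using N that .
    show ?thesis unfolding g_def
      using B hm dm by (intro Bochner_Integration.integral_diff integrable_const_bound[of _ B]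
        integrable_const_bound[of _ B']) auto
  qed
  ultimately show ?thesis
    by (simp add: algebra_simps sum_subtractf sum.distrib)
qed

subsection \<open>Kernels of distributions\<close>

text \<open>By Levy's continuity theorem \<open>F\<close> is weakly continuous, so integrals of
  bounded continuous functions are continuous in t. Each value of the distribution function is a
  limit of such integrals, hence measurable in t, and the half-lines \<open>{..a}\<close> generate
  the Borel sets.\<close>

lemma measurable_prob_algebra_char:
  fixes F :: "real \<Rightarrow> real measure"
  assumes F: "\<And>t. real_distribution (F t)" and ch: "\<And>z. continuous_on UNIV (\<lambda>t. char (F t) z)"
  shows "F \<in> borel \<rightarrow>\<^sub>M prob_algebra borel"
proof (rule measurable_prob_algebra_generated[where G="range (\<lambda>a::real. {..a})" and \<Omega>=UNIV])
  show "sets borel = sigma_sets UNIV (range (\<lambda>a::real. {..a}))"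
    by (subst borel_eq_atMost) (rule sets_measure_of, auto)
  show "Int_stable (range (\<lambda>a::real. {..a}))"
    by (auto simp: Int_stable_def intro!: exI[of _ "min _ _"])
  show "prob_space (F t)" "sets (F t) = sets borel" for t
    using F[of t] by (auto simp: real_distribution_def real_distribution_axioms_def)
  have cts: "continuous_on UNIV (\<lambda>t. integral\<^sup>L (F t) (cts_step a b))" if "a < b" for a b
    unfolding continuous_on_sequentially
  proof safe
    fix X :: "nat \<Rightarrow> real" and t assume X: "X \<longlonglongrightarrow> t"
    have "(\<lambda>n. char (F (X n)) z) \<longlonglongrightarrow> char (F t) z" for z
      using ch[of z] X by (auto simp: continuous_on_sequentially comp_def)
    then have w: "weak_conv_m (\<lambda>n. F (X n)) (F t)"
      by (intro levy_continuity F)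
    show "((\<lambda>t. integral\<^sup>L (F t) (cts_step a b)) \<circ> X) \<longlonglongrightarrow> integral\<^sup>L (F t) (cts_step a b)"
      unfolding comp_def
    proof (rule weak_conv_imp_integral_bdd_continuous_conv[OF F F w])
      show "isCont (cts_step a b) x" for x
        using uniformly_continuous_imp_continuous[OF cts_step_uniformly_continuous[OF that]]
        by (simp add: continuous_on_eq_continuous_at)
      show "norm (cts_step a b x) \<le> 1" for x
        using that by (auto simp: cts_step_def)
    qed
  qed
  have "(\<lambda>t. cdf (F t) a) \<in> borel_measurable borel" for a
  proof (rule borel_measurable_LIMSEQ_metric)
    show "(\<lambda>t. integral\<^sup>L (F t) (cts_step a (a + inverse (real (Suc n))))) \<in> borel_measurable borel" for n
      by (intro borel_measurable_continuous_onI cts) simp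
    fix t
    interpret real_distribution "F t" by (rule F)
    have "filterlim (\<lambda>n. a + inverse (real (Suc n))) (at_right a) sequentially"
      unfolding filterlim_at
    proof (intro conjI always_eventually allI)
      show "(\<lambda>n. a + inverse (real (Suc n))) \<longlonglongrightarrow> a"
        using tendsto_add[OF tendsto_const[of a] LIMSEQ_inverse_real_of_nat] by simp
    qed auto
    moreover have "(cdf (F t) \<longlongrightarrow> cdf (F t) a) (at_right a)"
      using cdf_is_right_cont[of a] by (simp add: continuous_within)
    ultimately have l: "(\<lambda>n. cdf (F t) (a + inverse (real (Suc n)))) \<longlonglongrightarrow> cdf (F t) a"
      by (rule filterlim_compose[rotated])
    \<comment> \<open>The ramp integral lies between the distribution function at a and at
      \<open>a + inverse (real (Suc n))\<close>; right continuity closes the gap.\<close>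
    show "(\<lambda>n. integral\<^sup>L (F t) (cts_step a (a + inverse (real (Suc n))))) \<longlonglongrightarrow> cdf (F t) a"
      by (rule tendsto_sandwich[OF _ _ tendsto_const l])
         (auto intro!: always_eventually cdf_cts_step)
  qed
  moreover have "emeasure (F t) {..a} = ennreal (cdf (F t) a)" for t a
  proof -
    interpret real_distribution "F t" by (rule F)
    show ?thesis by (simp add: cdf_def emeasure_eq_measure)
  qed
  ultimately show "(\<lambda>t. emeasure (F t) A) \<in> borel_measurable borel"
    if "A \<in> range (\<lambda>a::real. {..a})" for A
    using that by auto
qed auto

text \<open>The weight is normalised to a probability density and used as mixing law. Keeping the
  total mass as a factor on the left lets the statement cover mass zero too.\<close>

lemma real_distribution_weighted_mixture:
  fixes q :: "real \<Rightarrow> real" and K :: "real \<Rightarrow> real measure"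
  assumes q: "integrable lborel q" "\<And>u. 0 \<le> q u" and K: "K \<in> borel \<rightarrow>\<^sub>M prob_algebra borel"
  obtains P where "real_distribution P"
    "\<And>z. integral\<^sup>L lborel q * char P z = (LINT u|lborel. q u * char (K u) z)"
    "\<And>(g::real \<Rightarrow> real) B. g \<in> borel_measurable borel \<Longrightarrow> (\<And>x. \<bar>g x\<bar> \<le> B) \<Longrightarrow>
       integral\<^sup>L lborel q * integral\<^sup>L P g = (LINT u|lborel. q u * integral\<^sup>L (K u) g)"
proof (cases "integral\<^sup>L lborel q = 0")
  case True
  then have ae: "AE u in lborel. q u = 0"
    using q by (simp add: integral_nonneg_eq_0_iff_AE)
  show thesis
  \<comment> \<open>With total mass zero both sides vanish; \<open>exp_law\<close> is an arbitrary
    witness.\<close>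
  proof (rule that[OF real_distribution_exp_law])
    show "integral\<^sup>L lborel q * char exp_law z = (LINT u|lborel. q u * char (K u) z)" for z
      unfolding True by (subst integral_eq_zero_AE) (use ae in auto)
    show "integral\<^sup>L lborel q * integral\<^sup>L exp_law g = (LINT u|lborel. q u * integral\<^sup>L (K u) g)"
      for g :: "real \<Rightarrow> real"
      unfolding True by (subst integral_eq_zero_AE) (use ae in auto)
  qed
next
  case False
  define c where "c = integral\<^sup>L lborel q"
  have c: "c > 0" using False q by (simp add: c_def order_less_le)
  have qm[measurable]: "q \<in> borel_measurable borel" using q(1) by auto
  define Q where "Q = density lborel (\<lambda>u. ennreal (q u / c))"
  have Qs[measurable_cong, simp]: "sets Q = sets borel" by (simp add: Q_def)
  have "emeasure Q (space Q) = (\<integral>\<^sup>+u. ennreal (q u / c) \<partial>lborel)"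
    unfolding Q_def by (subst emeasure_density) auto
  also have "\<dots> = ennreal (LINT u|lborel. q u / c)"
    using q c by (intro nn_integral_eq_integral) auto
  also have "\<dots> = 1" using c by (simp add: c_def)
  finally interpret Q: prob_space Q by (rule prob_spaceI)
  have KQ: "K \<in> Q \<rightarrow>\<^sub>M prob_algebra borel" using K by (simp cong: measurable_cong_sets)
  note K'[measurable] = measurable_prob_algebraD[OF K]
  have P: "real_distribution (Q \<bind> K)"
    unfolding real_distribution_iff_prob_algebra
    using KQ prob_space_bind'[of Q Q K borel] sets_bind'[of Q Q K borel]
    by (auto simp: space_prob_algebra Q.prob_space_axioms)
  show thesis
  proof (rule that[OF P])
    fix z
    have m: "(\<lambda>u. char (K u) z) \<in> borel_measurable borel"
      unfolding char_def by measurable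
    have "char (Q \<bind> K) z = (LINT u|Q. char (K u) z)"
      unfolding char_def
      by (rule integral_bind_complex[OF _ _ KQ, where B=1]) (auto simp: Q.prob_space_axioms)
    also have "\<dots> = (LINT u|lborel. (q u / c) *\<^sub>R char (K u) z)"
      unfolding Q_def using c q m by (intro integral_density) auto
    also have "\<dots> = (LINT u|lborel. q u * char (K u) z / c)"
      by (simp add: scaleR_conv_of_real)
    also have "\<dots> = (LINT u|lborel. q u * char (K u) z) / c" by simp
    finally show "integral\<^sup>L lborel q * char (Q \<bind> K) z = (LINT u|lborel. q u * char (K u) z)"
      using c by (simp add: c_def)
  next
    fix g :: "real \<Rightarrow> real" and B
    assume g[measurable]: "g \<in> borel_measurable borel" and B: "\<And>x. \<bar>g x\<bar> \<le> B"
    have m: "(\<lambda>u. integral\<^sup>L (K u) g) \<in> borel_measurable borel" by measurable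
    have "integral\<^sup>L (Q \<bind> K) g = (LINT u|Q. integral\<^sup>L (K u) g)"
      using B by (intro integral_bind_prob[OF g _ KQ, where B=B]) (auto simp: Q.prob_space_axioms)
    also have "\<dots> = (LINT u|lborel. (q u / c) *\<^sub>R integral\<^sup>L (K u) g)"
      unfolding Q_def using c q m by (intro integral_density) auto
    also have "\<dots> = (LINT u|lborel. q u * integral\<^sup>L (K u) g) / c" by simp
    finally show "integral\<^sup>L lborel q * integral\<^sup>L (Q \<bind> K) g = (LINT u|lborel. q u * integral\<^sup>L (K u) g)"
      using c by (simp add: c_def)
  qed
qed

subsection \<open>Exponents of Levy densities with finite first moment\<close>

text \<open>This form makes the derivative a limit of difference quotients, to which dominated
  convergence along sequences applies.\<close>

lemma has_vector_derivative_iff_slope: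
  "(f has_vector_derivative D) (at x) \<longleftrightarrow> ((\<lambda>y. (f y - f x) /\<^sub>R (y - x)) \<longlongrightarrow> D) (at x)"
proof -
  have e: "norm (f y - f x - (y - x) *\<^sub>R D) / norm (y - x) = norm ((f y - f x) /\<^sub>R (y - x) - D)"
    if "y \<noteq> x" for y
  proof -
    have "(f y - f x) /\<^sub>R (y - x) - D = (f y - f x - (y - x) *\<^sub>R D) /\<^sub>R (y - x)"
      using that by (simp add: scaleR_diff_right)
    then show ?thesis by (simp add: divide_inverse mult.commute)
  qed
  have "(f has_vector_derivative D) (at x) \<longleftrightarrow>
      ((\<lambda>y. norm (f y - f x - (y - x) *\<^sub>R D) / norm (y - x)) \<longlongrightarrow> 0) (at x)"
    unfolding has_vector_derivative_def has_derivative_iff_norm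
    by (simp add: bounded_linear_scaleR_left)
  also have "\<dots> \<longleftrightarrow> ((\<lambda>y. norm ((f y - f x) /\<^sub>R (y - x) - D)) \<longlongrightarrow> 0) (at x)"
    by (intro filterlim_cong refl) (auto simp: eventually_at_filter e[unfolded real_norm_def] intro!: always_eventually)
  also have "\<dots> \<longleftrightarrow> ((\<lambda>y. (f y - f x) /\<^sub>R (y - x)) \<longlongrightarrow> D) (at x)"
    by (simp add: tendsto_norm_zero_iff LIM_zero_iff)
  finally show ?thesis .
qed

lemma cmod_iexp_diff_le: "cmod (iexp a - iexp b) \<le> \<bar>a - b\<bar>"
proof -
  have "iexp a - iexp b = iexp b * (iexp (a - b) - 1)"
    by (simp add: right_diff_distrib exp_add[symmetric] algebra_simps)
  then have "cmod (iexp a - iexp b) = cmod (iexp (a - b) - 1)"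
    by (simp add: norm_mult)
  also have "\<dots> \<le> \<bar>a - b\<bar>"
    using iexp_approx1[of "a - b" 0] by simp
  finally show ?thesis .
qed

text \<open>The Levy-Khintchine exponent without drift or compensator; the finite first moment
  required in \<open>levy_density\<close> makes the integral converge.\<close>

definition levy_exponent :: "(real \<Rightarrow> real) \<Rightarrow> real \<Rightarrow> complex" where
  "levy_exponent \<rho> z = (LINT u|lborel. \<rho> u *\<^sub>R (iexp (z * u) - 1))"

text \<open>The density may have infinite mass near 0, so it is paired with functions bounded by a
  multiple of |u|.\<close>

locale levy_density =
  fixes \<rho> :: "real \<Rightarrow> real"
  assumes rho_measurable[measurable]: "\<rho> \<in> borel_measurable borel"
    and rho_nonneg: "\<And>u. 0 \<le> \<rho> u"
    and rho_integrable: "integrable lborel (\<lambda>u. u * \<rho> u)"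
begin

lemma abs_integrable: "integrable lborel (\<lambda>u. \<bar>u\<bar> * \<rho> u)"
  using integrable_abs[OF rho_integrable] by (simp add: abs_mult rho_nonneg)

lemma exponent_integrable: "integrable lborel (\<lambda>u. \<rho> u *\<^sub>R (iexp (z * u) - 1))"
proof (rule Bochner_Integration.integrable_bound)
  show "integrable lborel (\<lambda>u. \<bar>z\<bar> * (\<bar>u\<bar> * \<rho> u))"
    using abs_integrable by (rule integrable_mult_right)
  have "\<rho> u * cmod (iexp (z * u) - 1) \<le> \<rho> u * \<bar>z * u\<bar>" for u
    using cmod_iexp_diff_le[of "z * u" 0] by (intro mult_left_mono rho_nonneg) simp
  then show "AE u in lborel. norm (\<rho> u *\<^sub>R (iexp (z * u) - 1)) \<le> norm (\<bar>z\<bar> * (\<bar>u\<bar> * \<rho> u))"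
    by (auto simp: rho_nonneg abs_mult mult_ac)
qed measurable

text \<open>Fourier transform of the finite signed measure with density \<open>u * \<rho> u\<close>,
  which is the measure in the jump term of the Stein equation.\<close>

definition jump_transform :: "real \<Rightarrow> complex" where
  "jump_transform z = (LINT u|lborel. (u * \<rho> u) *\<^sub>R iexp (z * u))"

lemma cmod_jump_transform_le: "cmod (jump_transform z) \<le> (LINT u|lborel. \<bar>u\<bar> * \<rho> u)"
proof -
  have "cmod (jump_transform z) \<le> (LINT u|lborel. cmod ((u * \<rho> u) *\<^sub>R iexp (z * u)))"
    unfolding jump_transform_def by (rule integral_norm_bound)
  then show ?thesis by (simp add: abs_mult rho_nonneg)
qed

lemma continuous_jump_transform: "continuous_on UNIV jump_transform"
  unfolding continuous_on_sequentially
proof safe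
  fix X :: "nat \<Rightarrow> real" and z assume X: "X \<longlonglongrightarrow> z"
  show "(jump_transform \<circ> X) \<longlonglongrightarrow> jump_transform z"
    unfolding comp_def jump_transform_def
    by (rule integral_dominated_convergence[where w="\<lambda>u. \<bar>u\<bar> * \<rho> u"])
       (auto intro!: tendsto_intros X abs_integrable simp: abs_mult rho_nonneg)
qed

text \<open>Differentiation under the integral: by \<open>cmod_iexp_diff_le\<close> the difference
  quotients are dominated by \<open>\<bar>u\<bar> * \<rho> u\<close>.\<close>

lemma levy_exponent_has_derivative:
  "(levy_exponent \<rho> has_vector_derivative \<i> * jump_transform z) (at z)"
proof -
  have "((\<lambda>y. (levy_exponent \<rho> y - levy_exponent \<rho> z) /\<^sub>R (y - z)) \<longlongrightarrow> \<i> * jump_transform z) (at z)"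
    unfolding tendsto_at_iff_sequentially
  proof safe
    fix X :: "nat \<Rightarrow> real" assume X: "\<forall>i. X i \<in> UNIV - {z}" and lim: "X \<longlonglongrightarrow> z"
    have "(\<lambda>n. LINT u|lborel. \<rho> u *\<^sub>R ((iexp (X n * u) - iexp (z * u)) /\<^sub>R (X n - z)))
      \<longlonglongrightarrow> (LINT u|lborel. \<rho> u *\<^sub>R (\<i> * u * iexp (z * u)))"
    proof (rule integral_dominated_convergence[where w="\<lambda>u. \<bar>u\<bar> * \<rho> u"])
      show "AE u in lborel. (\<lambda>n. \<rho> u *\<^sub>R ((iexp (X n * u) - iexp (z * u)) /\<^sub>R (X n - z)))
          \<longlonglongrightarrow> \<rho> u *\<^sub>R (\<i> * u * iexp (z * u))"
      proof (intro AE_I2 tendsto_scaleR tendsto_const)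
        fix u :: real
        have "((\<lambda>w. iexp (w * u)) has_vector_derivative \<i> * u * iexp (z * u)) (at z)"
          by (auto intro!: derivative_eq_intros has_vector_derivative_real_field)
        then have "((\<lambda>y. (iexp (y * u) - iexp (z * u)) /\<^sub>R (y - z)) \<longlongrightarrow> \<i> * u * iexp (z * u)) (at z)"
          by (simp only: has_vector_derivative_iff_slope)
        then show "(\<lambda>n. (iexp (X n * u) - iexp (z * u)) /\<^sub>R (X n - z)) \<longlonglongrightarrow> \<i> * u * iexp (z * u)"
          using X lim by (auto simp: tendsto_at_iff_sequentially comp_def)
      qed
      show "AE u in lborel. norm (\<rho> u *\<^sub>R ((iexp (X n * u) - iexp (z * u)) /\<^sub>R (X n - z))) \<le> \<bar>u\<bar> * \<rho> u" for n
      proof (rule AE_I2)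
        fix u :: real
        have "cmod (iexp (X n * u) - iexp (z * u)) \<le> \<bar>X n - z\<bar> * \<bar>u\<bar>"
          using cmod_iexp_diff_le[of "X n * u" "z * u"]
          by (simp add: left_diff_distrib[symmetric] abs_mult)
        moreover have "\<bar>X n - z\<bar> > 0" using X by auto
        ultimately have "cmod ((iexp (X n * u) - iexp (z * u)) /\<^sub>R (X n - z)) \<le> \<bar>u\<bar>"
          by (simp add: divide_simps mult.commute del: of_real_mult)
        then show "norm (\<rho> u *\<^sub>R ((iexp (X n * u) - iexp (z * u)) /\<^sub>R (X n - z))) \<le> \<bar>u\<bar> * \<rho> u"
          using mult_right_mono[OF _ rho_nonneg[of u]]
          by (simp only: norm_scaleR abs_of_nonneg[OF rho_nonneg] mult.commute[of "\<rho> u"])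
      qed
    qed (use abs_integrable in auto)
    also have "(\<lambda>n. LINT u|lborel. \<rho> u *\<^sub>R ((iexp (X n * u) - iexp (z * u)) /\<^sub>R (X n - z)))
      = (\<lambda>n. (levy_exponent \<rho> (X n) - levy_exponent \<rho> z) /\<^sub>R (X n - z))"
    proof
      fix n
      have "levy_exponent \<rho> (X n) - levy_exponent \<rho> z
          = (LINT u|lborel. \<rho> u *\<^sub>R (iexp (X n * u) - iexp (z * u)))"
        unfolding levy_exponent_def
        by (subst Bochner_Integration.integral_diff[OF exponent_integrable exponent_integrable, symmetric])
           (simp add: scaleR_diff_right[symmetric])
      then show "(LINT u|lborel. \<rho> u *\<^sub>R ((iexp (X n * u) - iexp (z * u)) /\<^sub>R (X n - z)))
          = (levy_exponent \<rho> (X n) - levy_exponent \<rho> z) /\<^sub>R (X n - z)"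
        by (simp add: scaleR_left_commute[of "\<rho> _"] del: scaleR_scaleR of_real_mult)
    qed
    also have "(LINT u|lborel. \<rho> u *\<^sub>R (\<i> * u * iexp (z * u))) = \<i> * jump_transform z"
      unfolding jump_transform_def integral_mult_right_zero[symmetric]
      by (intro Bochner_Integration.integral_cong) (auto simp: scaleR_conv_of_real)
    finally show "((\<lambda>y. (levy_exponent \<rho> y - levy_exponent \<rho> z) /\<^sub>R (y - z)) \<circ> X)
        \<longlonglongrightarrow> \<i> * jump_transform z"
      by (simp add: comp_def)
  qed
  then show ?thesis
    by (simp only: has_vector_derivative_iff_slope)
qed

end

subsection \<open>The Stein equation for self-decomposable families\<close>

text \<open>The quotient of the characteristic functions at z and \<open>exp (- t) * z\<close> is
  written as the exponential of a difference of exponents, the form that is differentiated in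
  t.\<close>

locale selfdecomposable_family = levy_density +
  fixes F :: "real \<Rightarrow> real measure"
  assumes F_distribution: "\<And>t. 0 \<le> t \<Longrightarrow> real_distribution (F t)"
    and F_char: "\<And>t z. 0 \<le> t \<Longrightarrow>
      char (F t) z = exp (levy_exponent \<rho> z - levy_exponent \<rho> (exp (- t) * z))"
begin

lemma continuous_levy_exponent: "isCont (levy_exponent \<rho>) z"
  using levy_exponent_has_derivative by (rule has_vector_derivative_continuous)

lemma continuous_family_char: "continuous_on UNIV (\<lambda>t. char (F (max 0 t)) z)"
proof -
  have "(\<lambda>t. char (F (max 0 t)) z) =
      (\<lambda>t. exp (levy_exponent \<rho> z - levy_exponent \<rho> (exp (- max 0 t) * z)))"
    by (simp add: F_char)
  moreover have "continuous_on UNIV \<dots>"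
  proof -
    have "continuous_on UNIV (levy_exponent \<rho>)"
      by (simp add: continuous_at_imp_continuous_on continuous_levy_exponent)
    then have "continuous_on UNIV (\<lambda>t. levy_exponent \<rho> (exp (- max 0 t) * z))"
      by (rule continuous_on_compose2) (auto intro!: continuous_intros)
    then show ?thesis by (intro continuous_intros)
  qed
  ultimately show ?thesis by (simp only:)
qed

text \<open>Negative times have mass zero under \<open>exp_law\<close>; \<open>max 0 t\<close> only avoids the unspecified measures
  \<open>F t\<close> with \<open>t < 0\<close>.\<close>

definition resolvent_kernel :: "real \<Rightarrow> real measure" where
  "resolvent_kernel x =
     exp_law \<bind> (\<lambda>t. distr (F (max 0 t)) borel (\<lambda>y. x * exp (- t) + y))"

lemma measurable_family[measurable]: "(\<lambda>t. F (max 0 t)) \<in> borel \<rightarrow>\<^sub>M prob_algebra borel"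
  by (intro measurable_prob_algebra_char continuous_family_char F_distribution) simp

lemma measurable_shifted_family:
  "(\<lambda>t. distr (F (max 0 t)) borel (\<lambda>y. x * exp (- t) + y)) \<in> borel \<rightarrow>\<^sub>M prob_algebra borel"
  by measurable

lemma exp_law_in_prob_algebra: "exp_law \<in> space (prob_algebra borel)"
  using real_distribution_exp_law by (simp add: real_distribution_iff_prob_algebra)

lemma measurable_resolvent_kernel[measurable]: "resolvent_kernel \<in> borel \<rightarrow>\<^sub>M prob_algebra borel"
  unfolding resolvent_kernel_def
proof (rule measurable_bind_prob_space2[where N=borel])
  show "(\<lambda>x. exp_law) \<in> borel \<rightarrow>\<^sub>M prob_algebra borel"
    using exp_law_in_prob_algebra by (rule measurable_const)
qed measurable

lemma resolvent_kernel_distribution: "real_distribution (resolvent_kernel x)"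
  unfolding real_distribution_iff_prob_algebra
  using measurable_space[OF measurable_resolvent_kernel, of x] by simp

lemma measurable_shifted_family_exp_law:
  "(\<lambda>t. distr (F (max 0 t)) borel (\<lambda>y. x * exp (- t) + y)) \<in> exp_law \<rightarrow>\<^sub>M prob_algebra borel"
  using measurable_shifted_family
  by (simp add: exp_law_def cong: measurable_cong_sets)

lemma char_resolvent_kernel:
  "char (resolvent_kernel x) z =
     (LINT t|exp_law. iexp (z * x * exp (- t)) * char (F (max 0 t)) z)"
proof -
  interpret E: real_distribution exp_law by (rule real_distribution_exp_law)
  have "char (resolvent_kernel x) z =
      (LINT t|exp_law. char (distr (F (max 0 t)) borel (\<lambda>y. x * exp (- t) + y)) z)"
    unfolding char_def resolvent_kernel_def
    by (rule integral_bind_complex[OF _ _ measurable_shifted_family_exp_law, where B=1])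
       (auto simp: E.prob_space_axioms)
  also have "\<dots> = (LINT t|exp_law. iexp (z * x * exp (- t)) * char (F (max 0 t)) z)"
  proof (rule Bochner_Integration.integral_cong[OF refl])
    fix t
    interpret F: real_distribution "F (max 0 t)" by (intro F_distribution) simp
    have "char (distr (F (max 0 t)) borel (\<lambda>y. x * exp (- t) + y)) z
        = (LINT y|F (max 0 t). iexp (z * (x * exp (- t) + y)))"
      unfolding char_def by (subst integral_distr) auto
    also have "\<dots> = (LINT y|F (max 0 t). iexp (z * x * exp (- t)) * iexp (z * y))"
      by (simp add: exp_add[symmetric] algebra_simps)
    finally show "char (distr (F (max 0 t)) borel (\<lambda>y. x * exp (- t) + y)) z
        = iexp (z * x * exp (- t)) * char (F (max 0 t)) z"
      by (simp add: char_def)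
  qed
  finally show ?thesis .
qed

lemma integral_resolvent_kernel:
  fixes g :: "real \<Rightarrow> real"
  assumes g[measurable]: "g \<in> borel_measurable borel" and B: "\<And>x. \<bar>g x\<bar> \<le> B"
  shows "integral\<^sup>L (resolvent_kernel x) g =
      (LINT t:{0..}|lborel. exp (- t) * (LINT y|F t. g (x * exp (- t) + y)))"
    and "set_integrable lborel {0..} (\<lambda>t. exp (- t) * (LINT y|F t. g (x * exp (- t) + y)))"
proof -
  interpret E: real_distribution exp_law by (rule real_distribution_exp_law)
  \<comment> \<open>\<open>G\<close> is Borel on the whole line and agrees for nonnegative t with
    the inner integral of the Stein solution.\<close>
  define G where "G t = integral\<^sup>L (distr (F (max 0 t)) borel (\<lambda>y. x * exp (- t) + y)) g" for t
  have m: "G \<in> borel_measurable borel"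
    unfolding G_def by (rule measurable_compose[OF measurable_prob_algebraD[OF measurable_shifted_family]]) measurable
  have eq: "G t = (LINT y|F t. g (x * exp (- t) + y))" if "0 \<le> t" for t
  proof -
    interpret F: real_distribution "F t" using that by (rule F_distribution)
    show ?thesis using that unfolding G_def by (subst integral_distr) auto
  qed
  have "integral\<^sup>L (resolvent_kernel x) g = (LINT t|exp_law. G t)"
    unfolding resolvent_kernel_def G_def using B
    by (intro integral_bind_prob[OF g _ measurable_shifted_family_exp_law, where B=B])
       (auto simp: E.prob_space_axioms)
  also have "\<dots> = (LINT t:{0..}|lborel. exp (- t) *\<^sub>R G t)"
    by (rule integral_exp_law[OF m])
  also have "\<dots> = (LINT t:{0..}|lborel. exp (- t) * (LINT y|F t. g (x * exp (- t) + y)))"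
    by (rule set_lebesgue_integral_cong) (auto simp: eq)
  finally show "integral\<^sup>L (resolvent_kernel x) g =
      (LINT t:{0..}|lborel. exp (- t) * (LINT y|F t. g (x * exp (- t) + y)))" .
  have "set_integrable lborel {0..} (\<lambda>t. exp (- t) *\<^sub>R G t)"
  proof (rule set_integrable_exp_bounded[OF m])
    fix t :: real assume t: "0 \<le> t"
    interpret F: real_distribution "F t" using t by (rule F_distribution)
    have "norm (LINT y|F t. g (x * exp (- t) + y)) \<le> B"
      using B by (intro F.norm_expectation_le) auto
    then show "norm (G t) \<le> B" using t by (simp add: eq)
  qed
  then show "set_integrable lborel {0..} (\<lambda>t. exp (- t) * (LINT y|F t. g (x * exp (- t) + y)))"
    by (rule set_integrable_cong[THEN iffD1, rotated 3]) (auto simp: eq)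
qed

text \<open>Fubini with majorant \<open>\<bar>u * \<rho> u\<bar>\<close>, integrable since
  \<open>exp_law\<close> has mass 1. For fixed t the jump u enters only through
  \<open>iexp (z * exp (- t) * u)\<close>, whose weighted integral is the jump transform at
  \<open>z * exp (- t)\<close>.\<close>

lemma char_resolvent_kernel_jumps:
  "(LINT u|lborel. (u * \<rho> u) *\<^sub>R char (resolvent_kernel (x + u)) z) =
    (LINT t|exp_law. iexp (z * x * exp (- t)) * char (F (max 0 t)) z * jump_transform (z * exp (- t)))"
proof -
  interpret E: real_distribution exp_law by (rule real_distribution_exp_law)
  interpret P: pair_sigma_finite lborel exp_law ..
  have [measurable]: "(\<lambda>t. char (F (max 0 t)) z) \<in> borel_measurable borel"
    by (rule borel_measurable_continuous_onI[OF continuous_family_char])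
  have c1: "cmod (char (F (max 0 t)) z) \<le> 1" for t
  proof -
    interpret F: real_distribution "F (max 0 t)" by (intro F_distribution) simp
    show ?thesis by (rule F.cmod_char_le_1)
  qed
  let ?f = "\<lambda>u t. (u * \<rho> u) *\<^sub>R (iexp (z * (x + u) * exp (- t)) * char (F (max 0 t)) z)"
  have bound: "norm (?f u t) \<le> \<bar>u * \<rho> u\<bar>" for u t
    using mult_left_mono[OF c1[of t] abs_ge_zero[of "u * \<rho> u"]]
    by (simp add: norm_mult del: of_real_mult of_real_add)
  have m: "(\<lambda>(u, t). ?f u t) \<in> borel_measurable (lborel \<Otimes>\<^sub>M exp_law)"
    unfolding exp_law_def by measurable
  have m2: "?f u \<in> borel_measurable exp_law" for u
    unfolding exp_law_def by measurable
  have int2: "integrable exp_law (?f u)" for u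
    using bound by (intro E.integrable_const_bound[of _ "\<bar>u * \<rho> u\<bar>"] m2) auto
  have int: "integrable (lborel \<Otimes>\<^sub>M exp_law) (\<lambda>(u, t). ?f u t)"
  proof (rule P.Fubini_integrable[OF m])
    show "integrable lborel (\<lambda>u. LINT t|exp_law. norm (case (u, t) of (u, t) \<Rightarrow> ?f u t))"
    proof (rule Bochner_Integration.integrable_bound[OF rho_integrable])
      have "(\<lambda>(u, t). norm (?f u t)) \<in> borel_measurable (lborel \<Otimes>\<^sub>M exp_law)"
        using measurable_compose[OF m borel_measurable_norm] by (simp add: case_prod_beta')
      then show "(\<lambda>u. LINT t|exp_law. norm (case (u, t) of (u, t) \<Rightarrow> ?f u t)) \<in> borel_measurable lborel"
        by (auto intro!: E.borel_measurable_lebesgue_integral)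
      have "norm (LINT t|exp_law. norm (?f u t)) \<le> norm (u * \<rho> u)" for u
        using bound m2 by (intro E.norm_expectation_le borel_measurable_norm) (auto simp del: norm_scaleR)
      then show "AE u in lborel. norm (LINT t|exp_law. norm (case (u, t) of (u, t) \<Rightarrow> ?f u t)) \<le> norm (u * \<rho> u)"
        by (simp only: prod.case AE_I2)
    qed
  qed (use int2 in auto)
  have "(LINT u|lborel. (u * \<rho> u) *\<^sub>R char (resolvent_kernel (x + u)) z)
      = (LINT u|lborel. LINT t|exp_law. ?f u t)"
    by (simp add: char_resolvent_kernel)
  also have "\<dots> = (LINT t|exp_law. LINT u|lborel. ?f u t)"
    using P.Fubini_integral[OF int] by simp
  also have "\<dots> = (LINT t|exp_law. iexp (z * x * exp (- t)) * char (F (max 0 t)) z * jump_transform (z * exp (- t)))"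
  proof (rule Bochner_Integration.integral_cong[OF refl])
    fix t
    have "?f u t = iexp (z * x * exp (- t)) * char (F (max 0 t)) z * ((u * \<rho> u) *\<^sub>R iexp (z * exp (- t) * u))" for u
    proof -
      have "iexp (z * (x + u) * exp (- t)) = iexp (z * x * exp (- t)) * iexp (z * exp (- t) * u)"
        by (simp add: exp_add[symmetric] algebra_simps)
      then show ?thesis by (simp add: mult_ac scaleR_conv_of_real)
    qed
    then show "(LINT u|lborel. ?f u t) = iexp (z * x * exp (- t)) * char (F (max 0 t)) z * jump_transform (z * exp (- t))"
      unfolding jump_transform_def by (simp only: integral_mult_right_zero)
  qed
  finally show ?thesis .
qed

text \<open>This is the negated Stein equation for the test function \<open>iexp (z * x)\<close>,
  whose Stein solution at x is \<open>- \<i> * z * char (resolvent_kernel x) z\<close>.\<close>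

lemma stein_identity_char:
  "exp (levy_exponent \<rho> z) - iexp (z * x) =
    \<i> * z * (- x * char (resolvent_kernel x) z
      + (LINT u|lborel. (u * \<rho> u) *\<^sub>R char (resolvent_kernel (x + u)) z))"
proof -
  interpret E: real_distribution exp_law by (rule real_distribution_exp_law)
  let ?\<psi> = "levy_exponent \<rho>"
  define C where "C = (LINT u|lborel. \<bar>u\<bar> * \<rho> u)"
  \<comment> \<open>Interpolates between \<open>iexp (z * x)\<close> at time 0 and the
    characteristic function \<open>exp (levy_exponent \<rho> z)\<close> as t tends to
    infinity.\<close>
  define H where "H t = exp (\<i> * (z * x * exp (- t)) + ?\<psi> z - ?\<psi> (z * exp (- t)))" for t :: real
  have HF: "iexp (z * x * exp (- t)) * char (F (max 0 t)) z = H t" if "0 \<le> t" for t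
  proof -
    have "iexp (z * x * exp (- t)) * char (F (max 0 t)) z
        = iexp (z * x * exp (- t)) * exp (?\<psi> z - ?\<psi> (z * exp (- t)))"
      using that by (simp add: F_char mult.commute)
    then show ?thesis unfolding exp_add[symmetric] H_def by (simp only: add_diff_eq)
  qed
  have [measurable]: "(\<lambda>t. char (F (max 0 t)) z) \<in> borel_measurable borel"
    by (rule borel_measurable_continuous_onI[OF continuous_family_char])
  have [measurable]: "jump_transform \<in> borel_measurable borel"
    by (rule borel_measurable_continuous_onI[OF continuous_jump_transform])
  have c1: "cmod (char (F (max 0 t)) z) \<le> 1" for t
  proof -
    interpret F: real_distribution "F (max 0 t)" by (intro F_distribution) simp
    show ?thesis by (rule F.cmod_char_le_1)
  qed
  let ?k = "\<lambda>t. iexp (z * x * exp (- t)) * char (F (max 0 t)) z"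
  let ?J = "\<lambda>t. jump_transform (z * exp (- t))"
  have km: "?k \<in> borel_measurable borel" "(\<lambda>t. ?k t * ?J t) \<in> borel_measurable borel"
    by measurable
  have k1: "norm (?k t) \<le> 1" for t
    using c1[of t] by (simp add: norm_mult del: of_real_mult)
  have kJ: "norm (?k t * ?J t) \<le> C" for t
    using mult_mono[OF k1[of t] cmod_jump_transform_le[of "z * exp (- t)"]]
    unfolding norm_mult[of "?k t"] C_def by simp
  have int: "integrable exp_law ?k" "integrable exp_law (\<lambda>t. ?k t * ?J t)"
    by (rule E.integrable_const_bound[OF AE_I2[OF k1] E.measurable_finite_borel[OF km(1)]])
       (rule E.integrable_const_bound[OF AE_I2[OF kJ] E.measurable_finite_borel[OF km(2)]])
  \<comment> \<open>The derivative of \<open>H\<close> without its factor \<open>exp (- t)\<close>,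
    which the density of \<open>exp_law\<close> supplies.\<close>
  let ?d = "\<lambda>t. \<i> * z * (- x * ?k t + ?k t * ?J t)"
  have "\<i> * z * (- x * char (resolvent_kernel x) z
      + (LINT u|lborel. (u * \<rho> u) *\<^sub>R char (resolvent_kernel (x + u)) z)) = (LINT t|exp_law. ?d t)"
    unfolding char_resolvent_kernel_jumps unfolding char_resolvent_kernel
    using int by (simp del: of_real_mult)
  also have "\<dots> = (LINT t:{0..}|lborel. exp (- t) *\<^sub>R ?d t)"
    by (rule integral_exp_law) measurable
  also have "\<dots> = exp (?\<psi> z) - H 0"
  proof (rule integral_FTC_atLeast_tendsto)
    show "set_integrable lborel {0..} (\<lambda>t. exp (- t) *\<^sub>R ?d t)"
    proof (rule set_integrable_exp_bounded)
      show "norm (?d t) \<le> \<bar>z\<bar> * (\<bar>x\<bar> + C)" for t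
      proof -
        have "norm (- x * ?k t + ?k t * ?J t) \<le> norm (- x * ?k t) + norm (?k t * ?J t)"
          by (rule norm_triangle_ineq)
        also have "\<dots> \<le> \<bar>x\<bar> + C"
          using kJ[of t] mult_left_mono[OF k1[of t] abs_ge_zero[of x]]
          by (intro add_mono) (simp_all add: norm_mult[of "complex_of_real x"] del: of_real_mult)
        finally show ?thesis
          unfolding norm_mult[of "\<i> * z"] by (simp add: norm_mult mult_left_mono del: of_real_mult)
      qed
    qed measurable
    fix t :: real assume t: "0 \<le> t"
    have "((\<lambda>t. z * exp (- t)) has_vector_derivative - z * exp (- t)) (at t)"
      by (auto intro!: derivative_eq_intros simp: has_real_derivative_iff_has_vector_derivative[symmetric])
    from vector_diff_chain_at[OF this levy_exponent_has_derivative]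
    have psi: "((\<lambda>t. ?\<psi> (z * exp (- t))) has_vector_derivative
        (- z * exp (- t)) *\<^sub>R (\<i> * ?J t)) (at t)"
      by (simp add: comp_def)
    have "((\<lambda>t. \<i> * complex_of_real (z * x * exp (- t))) has_vector_derivative
        \<i> * complex_of_real (- z * x * exp (- t))) (at t)"
      by (intro has_vector_derivative_mult_right has_vector_derivative_of_real)
         (auto intro!: derivative_eq_intros)
    then have "((\<lambda>t. \<i> * complex_of_real (z * x * exp (- t)) + ?\<psi> z - ?\<psi> (z * exp (- t)))
        has_vector_derivative \<i> * complex_of_real (- z * x * exp (- t)) + 0
          - (- z * exp (- t)) *\<^sub>R (\<i> * ?J t)) (at t)"
      by (intro has_vector_derivative_diff has_vector_derivative_add has_vector_derivative_const psi)
    from field_vector_diff_chain_at[OF this DERIV_exp]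
    have "(H has_vector_derivative (\<i> * complex_of_real (- z * x * exp (- t)) + 0
          - (- z * exp (- t)) *\<^sub>R (\<i> * ?J t)) * H t) (at t)"
      unfolding H_def comp_def .
    also have "(\<i> * complex_of_real (- z * x * exp (- t)) + 0
          - (- z * exp (- t)) *\<^sub>R (\<i> * ?J t)) * H t = exp (- t) *\<^sub>R ?d t"
      unfolding HF[OF t] by (simp add: scaleR_conv_of_real algebra_simps)
    finally show "(H has_vector_derivative exp (- t) *\<^sub>R ?d t) (at t within {0..})"
      by (rule has_vector_derivative_at_within)
  next
    have e: "((\<lambda>t::real. exp (- t)) \<longlongrightarrow> 0) at_top"
      by (intro filterlim_compose[OF exp_at_bot] filterlim_uminus_at_bot_at_top)
    \<comment> \<open>Continuity of the exponent at 0, where it vanishes, identifies the limit of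
      \<open>H\<close>.\<close>
    have "((\<lambda>t. z * exp (- t)) \<longlongrightarrow> z * 0) at_top" by (intro tendsto_intros e)
    then have "((\<lambda>t. ?\<psi> (z * exp (- t))) \<longlongrightarrow> ?\<psi> 0) at_top"
      by (intro isCont_tendsto_compose[OF continuous_levy_exponent]) simp
    then have "(H \<longlongrightarrow> exp (\<i> * complex_of_real (z * x * 0) + ?\<psi> z - ?\<psi> 0)) at_top"
      unfolding H_def by (intro tendsto_intros e)
    then show "(H \<longlongrightarrow> exp (?\<psi> z)) at_top"
      by (simp add: levy_exponent_def)
  qed
  also have "H 0 = iexp (z * x)" by (simp add: H_def)
  finally show ?thesis by simp
qed

section \<open>The Stein solution as a kernel integral, and the equation for general test
  functions\<close>

lemma stein_f_eq:
  assumes h: "\<And>x. h differentiable (at x)" and B: "\<And>x. \<bar>deriv h x\<bar> \<le> B"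
  shows "stein_f F h x = - integral\<^sup>L (resolvent_kernel x) (deriv h)"
  unfolding stein_f_def integral_resolvent_kernel(1)[OF borel_measurable_deriv_real[OF h] B] ..

lemma stein_f_well_defined:
  assumes h: "\<And>x. h differentiable (at x)" and B: "\<And>x. \<bar>deriv h x\<bar> \<le> B"
  shows "stein_f_well_defined F h x"
  unfolding stein_f_well_defined_def
proof (intro conjI allI impI)
  note dm[measurable] = borel_measurable_deriv_real[OF h]
  show "integrable (F t) (\<lambda>y. deriv h (x * exp (- t) + y))" if "0 \<le> t" for t
  proof -
    interpret F: real_distribution "F t" using that by (rule F_distribution)
    show ?thesis using B by (intro F.integrable_const_bound[of _ B]) auto
  qed
  show "set_integrable lborel {0..} (\<lambda>t. exp (- t) * (LINT y|F t. deriv h (x * exp (- t) + y)))"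
    by (rule integral_resolvent_kernel(2)[OF dm B])
qed

lemma abs_integral_resolvent_kernel_le:
  fixes g :: "real \<Rightarrow> real"
  assumes g[measurable]: "g \<in> borel_measurable borel" and B: "\<And>x. \<bar>g x\<bar> \<le> B"
  shows "\<bar>integral\<^sup>L (resolvent_kernel x) g\<bar> \<le> B"
proof -
  interpret K: real_distribution "resolvent_kernel x" by (rule resolvent_kernel_distribution)
  show ?thesis using B K.norm_expectation_le[of g B] by simp
qed

lemma integrable_jump_resolvent:
  fixes g :: "real \<Rightarrow> real"
  assumes g[measurable]: "g \<in> borel_measurable borel" and B: "\<And>x. \<bar>g x\<bar> \<le> B"
  shows "integrable lborel (\<lambda>u. u * \<rho> u * integral\<^sup>L (resolvent_kernel (x + u)) g)"
proof (rule Bochner_Integration.integrable_bound)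
  show "integrable lborel (\<lambda>u. B * (u * \<rho> u))" using rho_integrable by (rule integrable_mult_right)
  note [measurable] = measurable_prob_algebraD[OF measurable_resolvent_kernel]
  show "(\<lambda>u. u * \<rho> u * integral\<^sup>L (resolvent_kernel (x + u)) g) \<in> borel_measurable lborel"
    by measurable
  have "\<bar>u * \<rho> u\<bar> * \<bar>integral\<^sup>L (resolvent_kernel (x + u)) g\<bar> \<le> \<bar>u * \<rho> u\<bar> * B" for u
    by (intro mult_left_mono abs_integral_resolvent_kernel_le[OF g B]) simp
  moreover have "0 \<le> B" using B[of 0] by linarith
  ultimately show "AE u in lborel. norm (u * \<rho> u * integral\<^sup>L (resolvent_kernel (x + u)) g) \<le> norm (B * (u * \<rho> u))"
    by (auto simp: abs_mult mult_ac)
qed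

text \<open>The identity for exponentials is put into the finite form required by
  \<open>char_derivative_identity\<close>: the jump integral of the kernels is a signed measure,
  hence a difference of two scaled probability measures.\<close>

theorem stein_equation:
  assumes \<mu>: "real_distribution \<mu>" "\<And>z. char \<mu> z = exp (levy_exponent \<rho> z)"
    and h: "\<And>x. h differentiable (at x)" and B: "\<And>x. \<bar>h x\<bar> \<le> B" "\<And>x. \<bar>deriv h x\<bar> \<le> B'"
  shows "integrable lborel (\<lambda>u. \<rho> u * (u * stein_f F h (x + u)))"
    and "- x * stein_f F h x + (LINT u|lborel. \<rho> u * (u * stein_f F h (x + u))) = h x - integral\<^sup>L \<mu> h"
proof -
  note dm[measurable] = borel_measurable_deriv_real[OF h]
  have hm[measurable]: "h \<in> borel_measurable borel"
    by (rule borel_measurable_differentiable_real[OF h])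
  note f = stein_f_eq[OF h B(2)]
  let ?K = "\<lambda>u. resolvent_kernel (x + u)"
  let ?I = "\<lambda>x. integral\<^sup>L (resolvent_kernel x) (deriv h)"
  have feq: "\<rho> u * (u * stein_f F h (x + u)) = - (u * \<rho> u * ?I (x + u))" for u
    by (simp add: f)
  show "integrable lborel (\<lambda>u. \<rho> u * (u * stein_f F h (x + u)))"
    unfolding feq using integrable_jump_resolvent[OF dm B(2)] by simp
  \<comment> \<open>The jump weight has the sign of u; its positive and negative parts can each
    serve as the weight of a mixture.\<close>
  define qp where "qp u = max 0 (u * \<rho> u)" for u
  define qm where "qm u = max 0 (- (u * \<rho> u))" for u
  have q: "u * \<rho> u = qp u - qm u" for u by (auto simp: qp_def qm_def)
  have q0: "0 \<le> qp u" "0 \<le> qm u" for u by (auto simp: qp_def qm_def)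
  have qi: "integrable lborel qp" "integrable lborel qm"
    unfolding qp_def qm_def using rho_integrable by auto
  have [measurable]: "qp \<in> borel_measurable borel" "qm \<in> borel_measurable borel"
    using qi by auto
  have Km: "?K \<in> borel \<rightarrow>\<^sub>M prob_algebra borel" by measurable
  note [measurable] = measurable_prob_algebraD[OF Km]
  obtain P where P: "real_distribution P"
    "\<And>z. integral\<^sup>L lborel qp * char P z = (LINT u|lborel. qp u * char (?K u) z)"
    "\<And>(g::real \<Rightarrow> real) B. g \<in> borel_measurable borel \<Longrightarrow> (\<And>x. \<bar>g x\<bar> \<le> B) \<Longrightarrow>
       integral\<^sup>L lborel qp * integral\<^sup>L P g = (LINT u|lborel. qp u * integral\<^sup>L (?K u) g)"
    using real_distribution_weighted_mixture[OF qi(1) q0(1) Km] by blast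
  obtain Q where Q: "real_distribution Q"
    "\<And>z. integral\<^sup>L lborel qm * char Q z = (LINT u|lborel. qm u * char (?K u) z)"
    "\<And>(g::real \<Rightarrow> real) B. g \<in> borel_measurable borel \<Longrightarrow> (\<And>x. \<bar>g x\<bar> \<le> B) \<Longrightarrow>
       integral\<^sup>L lborel qm * integral\<^sup>L Q g = (LINT u|lborel. qm u * integral\<^sup>L (?K u) g)"
    using real_distribution_weighted_mixture[OF qi(2) q0(2) Km] by blast
  \<comment> \<open>Five laws: the target, the point mass at x, the kernel at x and the two jump
    mixtures. The list \<open>a\<close> carries the expectation of \<open>h\<close> minus
    \<open>h x\<close>, the list \<open>b\<close> the terms multiplied by
    \<open>\<i> * z\<close>.\<close>
  define N where "N i = [\<mu>, return borel x, resolvent_kernel x, P, Q] ! i" for i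
  define a where "a i = [1, -1, 0, 0, 0::real] ! i" for i
  define b where "b i = [0, 0, - x, integral\<^sup>L lborel qp, - integral\<^sup>L lborel qm] ! i" for i
  have ret: "real_distribution (return borel x)"
    by (simp add: real_distribution_iff_prob_algebra space_prob_algebra prob_space_return)
  have charK: "(\<lambda>u. char (?K u) z) \<in> borel_measurable borel" for z
    unfolding char_def by measurable
  have charK1: "cmod (char (?K u) z) \<le> 1" for u z
    by (rule real_distribution.cmod_char_le_1[OF resolvent_kernel_distribution])
  have set5: "{..<5::nat} = {0,1,2,3,4}" by auto
  have "(\<Sum>i<5. a i * integral\<^sup>L (N i) h) = (\<Sum>i<5. b i * integral\<^sup>L (N i) (deriv h))"
  proof (rule char_derivative_identity[OF _ _ _ h B])
    show "real_distribution (N i)" if "i \<in> {..<5}" for i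
      using that \<mu>(1) P(1) Q(1) ret resolvent_kernel_distribution
      by (auto simp: N_def set5)
    fix z
    have ip: "integrable lborel (\<lambda>u. q' u * char (?K u) z)"
      if "integrable lborel q'" "q' \<in> borel_measurable borel" for q' :: "real \<Rightarrow> real"
    proof (rule Bochner_Integration.integrable_bound[OF that(1)])
      show "(\<lambda>u. q' u * char (?K u) z) \<in> borel_measurable lborel"
        using that charK by measurable
      show "AE u in lborel. norm (q' u * char (?K u) z) \<le> norm (q' u)"
        using charK1 by (auto simp: norm_mult mult_left_le)
    qed
    have "(LINT u|lborel. (u * \<rho> u) *\<^sub>R char (?K u) z)
        = (LINT u|lborel. qp u * char (?K u) z - qm u * char (?K u) z)"
      unfolding q by (simp add: scaleR_conv_of_real left_diff_distrib)
    also have "\<dots> = integral\<^sup>L lborel qp * char P z - integral\<^sup>L lborel qm * char Q z"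
      unfolding P(2) Q(2) using qi by (intro Bochner_Integration.integral_diff ip) auto
    finally have J: "(LINT u|lborel. (u * \<rho> u) *\<^sub>R char (?K u) z) = \<dots>" .
    have "char (return borel x) z = iexp (z * x)"
      unfolding char_def by (subst integral_return) auto
    then have "(\<Sum>i<5. a i * char (N i) z) = exp (levy_exponent \<rho> z) - iexp (z * x)"
      by (simp add: set5 a_def N_def \<mu>(2))
    also have "\<dots> = \<i> * z * (\<Sum>i<5. b i * char (N i) z)"
      unfolding stein_identity_char J by (simp add: set5 b_def N_def)
    finally show "(\<Sum>i<5. a i * char (N i) z) = \<i> * z * (\<Sum>i<5. b i * char (N i) z)" .
  qed simp
  moreover have "(\<Sum>i<5. a i * integral\<^sup>L (N i) h) = integral\<^sup>L \<mu> h - h x"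
    by (simp add: set5 a_def N_def integral_return)
  moreover have "(\<Sum>i<5. b i * integral\<^sup>L (N i) (deriv h))
      = - x * ?I x + (LINT u|lborel. u * \<rho> u * ?I (x + u))"
  proof -
    have ip: "integrable lborel (\<lambda>u. q' u * ?I (x + u))"
      if "integrable lborel q'" "\<And>u. \<bar>q' u\<bar> \<le> \<bar>u * \<rho> u\<bar>" for q'
      using that integrable_jump_resolvent[OF dm B(2), of x]
      by (intro Bochner_Integration.integrable_bound[OF integrable_jump_resolvent[OF dm B(2), of x]])
         (auto simp: abs_mult intro!: mult_right_mono)
    have "(LINT u|lborel. u * \<rho> u * ?I (x + u)) = (LINT u|lborel. qp u * ?I (x + u) - qm u * ?I (x + u))"
      unfolding q by (simp add: left_diff_distrib)
    also have "\<dots> = integral\<^sup>L lborel qp * integral\<^sup>L P (deriv h) - integral\<^sup>L lborel qm * integral\<^sup>L Q (deriv h)"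
      unfolding P(3)[OF dm B(2)] Q(3)[OF dm B(2)]
      by (intro Bochner_Integration.integral_diff ip qi) (auto simp: qp_def qm_def)
    finally show ?thesis by (simp add: set5 b_def N_def)
  qed
  \<comment> \<open>Since the Stein solution is minus the kernel integral of \<open>deriv h\<close>,
    changing all signs gives the claim.\<close>
  ultimately have "integral\<^sup>L \<mu> h - h x = - x * ?I x + (LINT u|lborel. u * \<rho> u * ?I (x + u))"
    by simp
  then show "- x * stein_f F h x + (LINT u|lborel. \<rho> u * (u * stein_f F h (x + u))) = h x - integral\<^sup>L \<mu> h"
    unfolding feq by (simp add: f)
qed

end

subsection \<open>Two-sided tempered stable distributions\<close>

text \<open>The integrand is the norm of the Gamma integrand with parameter
  \<open>1 - \<beta>\<close>, which is positive, and rate \<open>c\<close>.\<close>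

lemma integrable_powr_exp:
  fixes \<beta> c :: real
  assumes "\<beta> < 1" "0 < c"
  shows "integrable lborel (\<lambda>u. indicator {0<..} u * (u powr (- \<beta>) * exp (- c * u)))"
proof -
  let ?z = "complex_of_real (1 - \<beta>)"
  have "set_integrable lebesgue {0<..} (\<lambda>t. cmod (complex_of_real t powr (?z - 1) / of_real (exp (c * t))))"
    using absolutely_integrable_Gamma_integral[of ?z c] assms by (intro set_integrable_norm) auto
  then have "integrable lebesgue (\<lambda>u. indicator {0<..} u * (u powr (- \<beta>) * exp (- c * u)))"
    unfolding set_integrable_def
    by (rule Bochner_Integration.integrable_cong[THEN iffD1, rotated 2])
       (auto simp: norm_divide norm_powr_real_powr exp_minus inverse_eq_divide split: split_indicator)
  then show ?thesis
    by (subst (asm) integrable_completion) auto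
qed

text \<open>The factor u lowers the singularity at the origin from order \<open>1 + \<beta>\<close>
  to order \<open>\<beta>\<close>, which is integrable. The negative half is the reflection of a
  positive one, with a minus sign.\<close>

lemma levy_density_tsd:
  fixes \<alpha>_p \<beta>_p lam_p \<alpha>_m \<beta>_m lam_m :: real
  assumes "0 < \<alpha>_p" "0 < lam_p" "0 < \<alpha>_m" "0 < lam_m" and "\<beta>_p < 1" "\<beta>_m < 1"
  shows "levy_density (tsd_levy_density \<alpha>_p \<beta>_p lam_p \<alpha>_m \<beta>_m lam_m)"
proof
  let ?\<rho> = "tsd_levy_density \<alpha>_p \<beta>_p lam_p \<alpha>_m \<beta>_m lam_m"
  show "?\<rho> \<in> borel_measurable borel"
    unfolding tsd_levy_density_def[abs_def] by measurable
  show "0 \<le> ?\<rho> u" for u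
    using assms by (simp add: tsd_levy_density_def)
  define e where "e \<beta> c u = indicator {0<..} u * (u powr (- \<beta>) * exp (- c * u))" for \<beta> c u :: real
  have e: "integrable lborel (e \<beta>_p lam_p)" "integrable lborel (e \<beta>_m lam_m)"
    unfolding e_def by (rule integrable_powr_exp; fact)+
  have "integrable lborel (\<lambda>u. e \<beta>_m lam_m (0 + (-1) * u))"
    by (rule lborel_integrable_real_affine[OF e(2)]) simp
  then have "integrable lborel (\<lambda>u. \<alpha>_p * e \<beta>_p lam_p u - \<alpha>_m * e \<beta>_m lam_m (- u))"
    using e(1) by auto
  moreover have "u * ?\<rho> u = \<alpha>_p * e \<beta>_p lam_p u - \<alpha>_m * e \<beta>_m lam_m (- u)" for u
  proof -
    have p: "v / v powr (1 + \<beta>) = v powr (- \<beta>)" if "0 < v" for v \<beta> :: real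
      using that by (simp add: powr_add powr_minus field_simps)
    consider "u > 0" | "u = 0" | "u < 0" by linarith
    then show ?thesis
    proof cases
      case 1
      then show ?thesis
        using p[OF 1, of \<beta>_p] by (simp add: tsd_levy_density_def e_def mult_ac divide_inverse)
    next
      case 3
      then have "u * ?\<rho> u = - (\<alpha>_m * exp (lam_m * u) * (- u / (- u) powr (1 + \<beta>_m)))"
        by (simp add: tsd_levy_density_def)
      also have "- u / (- u) powr (1 + \<beta>_m) = (- u) powr (- \<beta>_m)"
        using 3 by (intro p) simp
      finally show ?thesis
        using 3 by (simp add: e_def)
    qed (simp add: e_def)
  qed
  ultimately show "integrable lborel (\<lambda>u. u * ?\<rho> u)" by simp
qed

lemma (in levy_density) integral_levy_measure:
  fixes f :: "real \<Rightarrow> 'b::{banach, second_countable_topology}"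
  assumes f: "f \<in> borel_measurable borel"
  shows "integral\<^sup>L (density lborel (\<lambda>u. ennreal (\<rho> u))) f = (LINT u|lborel. \<rho> u *\<^sub>R f u)"
    and "integrable (density lborel (\<lambda>u. ennreal (\<rho> u))) f \<longleftrightarrow> integrable lborel (\<lambda>u. \<rho> u *\<^sub>R f u)"
  using f rho_nonneg by (auto simp: integral_density integrable_density)

lemma H_classD:
  assumes "h \<in> H_class r" "1 \<le> r"
  shows "h differentiable (at x)" "\<bar>h x\<bar> \<le> 1" "\<bar>deriv h x\<bar> \<le> 1"
proof -
  have b: "sup_norm ((deriv ^^ k) h) \<le> 1" if "k \<le> r" for k
    using assms that by (auto simp: H_class_def)
  \<comment> \<open>The supremum is extended-real, so a value of at most 1 bounds \<open>g\<close>
    at every point.\<close>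
  have s: "\<bar>g x\<bar> \<le> 1" if "sup_norm g \<le> 1" for g :: "real \<Rightarrow> real"
  proof -
    have "ereal \<bar>g x\<bar> \<le> sup_norm g" unfolding sup_norm_def by (rule SUP_upper) simp
    with that show ?thesis by (metis ereal_less_eq(3) one_ereal_def order_trans)
  qed
  have "\<forall>k<r. \<forall>x. ((deriv ^^ k) h) differentiable (at x)" using assms by (simp add: H_class_def)
  then show "h differentiable (at x)" using assms(2) by (metis funpow_0 less_le_trans zero_less_one)
  show "\<bar>h x\<bar> \<le> 1" using s[OF b[of 0]] by simp
  show "\<bar>deriv h x\<bar> \<le> 1" using s[OF b[of 1]] assms by simp
qed

theorem theorem3p9:
  fixes \<alpha>_p \<beta>_p lam_p \<alpha>_m \<beta>_m lam_m :: real
    and M :: "'a measure" and X :: "'a \<Rightarrow> real"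
    and F :: "real \<Rightarrow> real measure"
    and r :: nat and h :: "real \<Rightarrow> real"
  assumes "0 < \<alpha>_p" "0 < lam_p" "0 < \<alpha>_m" "0 < lam_m"
    and "0 \<le> \<beta>_p" "\<beta>_p < 1" "0 \<le> \<beta>_m" "\<beta>_m < 1"
    and "prob_space M"
    and "has_TSD M X \<alpha>_p \<beta>_p lam_p \<alpha>_m \<beta>_m lam_m"
    and "\<And>t. 0 \<le> t \<Longrightarrow> real_distribution (F t)"
    and "\<And>t z. 0 \<le> t \<Longrightarrow>
           char (F t) z = tsd_char \<alpha>_p \<beta>_p lam_p \<alpha>_m \<beta>_m lam_m z
                        / tsd_char \<alpha>_p \<beta>_p lam_p \<alpha>_m \<beta>_m lam_m (exp (- t) * z)"
    and "1 \<le> r"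
    and "h \<in> H_class r"
  shows "\<forall>x. stein_f_well_defined F h x \<and>
             integrable (tsd_levy_measure \<alpha>_p \<beta>_p lam_p \<alpha>_m \<beta>_m lam_m) (\<lambda>u. u * stein_f F h (x + u)) \<and>
             - x * stein_f F h x
               + (LINT u|tsd_levy_measure \<alpha>_p \<beta>_p lam_p \<alpha>_m \<beta>_m lam_m. u * stein_f F h (x + u))
             = h x - (LINT \<omega>|M. h (X \<omega>))"
proof
  fix x
  let ?\<rho> = "tsd_levy_density \<alpha>_p \<beta>_p lam_p \<alpha>_m \<beta>_m lam_m"
  interpret M: prob_space M by fact
  interpret L: levy_density ?\<rho> by (rule levy_density_tsd) fact+
  \<comment> \<open>Integration against the Levy measure is integration against its Lebesgue
    density, so the TSD characteristic function is the exponential of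
    \<open>levy_exponent\<close>.\<close>
  have char_eq: "tsd_char \<alpha>_p \<beta>_p lam_p \<alpha>_m \<beta>_m lam_m z = exp (levy_exponent ?\<rho> z)" for z
    unfolding tsd_char_def tsd_levy_measure_def levy_exponent_def
    by (subst L.integral_levy_measure) auto
  interpret S: selfdecomposable_family ?\<rho> F
  proof (intro selfdecomposable_family.intro selfdecomposable_family_axioms.intro)
    show "levy_density ?\<rho>" ..
    show "real_distribution (F t)" if "0 \<le> t" for t by (rule assms(11)[OF that])
    show "char (F t) z = exp (levy_exponent ?\<rho> z - levy_exponent ?\<rho> (exp (- t) * z))"
      if "0 \<le> t" for t z
      unfolding assms(12)[OF that] char_eq exp_diff ..
  qed
  have X: "X \<in> borel_measurable M" "\<And>z. char (distr M borel X) z = exp (levy_exponent ?\<rho> z)"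
    using assms(10) by (auto simp: has_TSD_def char_eq)
  have \<mu>: "real_distribution (distr M borel X)" using X(1) by simp
  note h = H_classD[OF assms(14,13)]
  note eq = S.stein_equation[OF \<mu> X(2) h]
  have dm: "deriv h \<in> borel_measurable borel" by (rule borel_measurable_deriv_real[OF h(1)])
  have hm: "h \<in> borel_measurable borel"
    by (rule borel_measurable_differentiable_real[OF h(1)])
  note [measurable] = measurable_prob_algebraD[OF S.measurable_resolvent_kernel] dm
  \<comment> \<open>Measurability, read off from the kernel representation, permits passing from the
    density back to the Levy measure.\<close>
  have fm: "(\<lambda>u. u * stein_f F h (x + u)) \<in> borel_measurable borel"
    unfolding S.stein_f_eq[OF h(1,3)] by measurable
  have "(LINT \<omega>|M. h (X \<omega>)) = integral\<^sup>L (distr M borel X) h"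
    using X(1) hm by (simp add: integral_distr)
  then show "stein_f_well_defined F h x \<and>
             integrable (tsd_levy_measure \<alpha>_p \<beta>_p lam_p \<alpha>_m \<beta>_m lam_m) (\<lambda>u. u * stein_f F h (x + u)) \<and>
             - x * stein_f F h x
               + (LINT u|tsd_levy_measure \<alpha>_p \<beta>_p lam_p \<alpha>_m \<beta>_m lam_m. u * stein_f F h (x + u))
             = h x - (LINT \<omega>|M. h (X \<omega>))"
    using eq[of x] S.stein_f_well_defined[OF h(1,3)]
    unfolding tsd_levy_measure_def L.integral_levy_measure[OF fm] by simp
qed

end
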